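(* Let $(X^\theta_t)_{t\in[0,T]}\subset\mathbb R^n$ solve the Itô stochastic differential equation $dX_t=b_\theta(X_t,t)\,dt+\sigma(X_t,t)\,dW_t$ with $b_\theta\in C_b^2(\mathbb R^n\times\mathbb R;\mathbb R^n)$ and $\sigma\in C_b^2(\mathbb R^n\times\mathbb R;\mathbb R^{n\times d})$, where $d$ is the dimension of the Brownian motion $W$. For $\Delta t>0$, the Euler--Maruyama scheme induces the Gaussian transition probability $$P^\theta_{\Delta t}(x,t,dx')=\mathcal N\big(x+\Delta t\,b_\theta(x,t),\ \Delta t\,\Sigma(x,t)\big),\qquad \Sigma(x,t)=\sigma(x,t)\sigma(x,t)^\top.$$ Then the weak derivative of $P^\theta_{\Delta t}$ with respect to $\theta$ admits a Hahn--Jordan decomposition $$\nabla_\theta P^\theta_{\Delta t}(x,t,dx')=c_\theta(x,t)\big(\rho_\theta^+(x,t,dx')-\rho_\theta^-(x,t,dx')\big),$$ where $\rho^\pm_\theta(x,t,\cdot)$ are mutually singular positive measures (normalized, with $c_\theta(x,t)$ the common scalar scaling factor). Consequently, for any bounded measurable $f:\mathbb R^n\to\mathbb R$, $$\nabla_\theta\int f(x')\,P^\theta_{\Delta t}(x,t,dx')=c_\theta(x,t)\Big(\int f(x')\,\rho^+_\theta(x,t,dx')-\int f(x')\,\rho^-_\theta(x,t,dx')\Big).$$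
   Context: $\theta$ is a scalar parameter and $\nabla_\theta$ denotes differentiation with respect to $\theta$. $C_b^2$ denotes twice-differentiable bounded functions. $\mathcal N(\mu,A)$ is the Gaussian law on $\mathbb R^n$ with mean $\mu$ and covariance $A$. The weak derivative (measure-valued derivative) $\nabla_\theta P^\theta_{\Delta t}(x,t,\cdot)$ is the bounded signed measure on $\mathbb R^n$ whose integral against every smooth and bounded test function $f$ equals $\nabla_\theta\int_{\mathbb R^n}f(x')\,P^\theta_{\Delta t}(x,t,dx')$. "Normalized" means total mass one.
   Formalization: The weak derivative is shown to exist where Σ(x,t) is invertible and b_θ(x,t) is differentiable in θ; the decomposition and the formula are stated at each (x,t) where it exists for all real θ (for σ=0 it can fail to exist). *)

theory Defs
  imports "HOL-Probability.Probability"
begin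

section \<open>Regularity classes\<close>

text \<open>Between finite-dimensional spaces, the Frechet derivative is itself differentiable
  (or of class \<open>C\<^sup>k\<close>) iff all directional derivatives are.\<close>

primrec Ck :: "nat \<Rightarrow> ('a::real_normed_vector \<Rightarrow> 'b::real_normed_vector) \<Rightarrow> bool" where
  "Ck 0 f \<longleftrightarrow> continuous_on UNIV f"
| "Ck (Suc k) f \<longleftrightarrow>
     (\<forall>x. f differentiable (at x)) \<and> (\<forall>v. Ck k (\<lambda>x. frechet_derivative f (at x) v))"

definition smooth :: "('a::real_normed_vector \<Rightarrow> 'b::real_normed_vector) \<Rightarrow> bool" where
  "smooth f \<longleftrightarrow> (\<forall>k. Ck k f)"

text \<open>Only the function itself is required to be bounded, and the second derivative is not
  required to be continuous or bounded.\<close>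

definition Cb2 :: "('a::real_normed_vector \<Rightarrow> 'b::real_normed_vector) \<Rightarrow> bool" where
  "Cb2 f \<longleftrightarrow>
     (\<forall>x. f differentiable (at x)) \<and>
     (\<forall>v x. (\<lambda>y. frechet_derivative f (at y) v) differentiable (at x)) \<and>
     bounded (range f)"

section \<open>Gaussian laws\<close>

text \<open>One-dimensional normal law with mean \<open>m\<close> and variance \<open>v\<close>; note that
  \<^const>\<open>normal_density\<close> takes the standard deviation.\<close>

definition normal_law :: "real \<Rightarrow> real \<Rightarrow> real measure" where
  "normal_law m v =
     (if v = 0 then return borel m else density lborel (normal_density m (sqrt v)))"

text \<open>\<open>M\<close> is the Gaussian law with mean \<open>\<mu>\<close> and (possibly singular) covariance \<open>A\<close>: every linear
  functional is normal, with the corresponding mean and variance.\<close>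

definition gaussian_law :: "real^'n \<Rightarrow> real^'n^'n \<Rightarrow> (real^'n) measure \<Rightarrow> bool" where
  "gaussian_law \<mu> A M \<longleftrightarrow>
     prob_space M \<and> sets M = sets borel \<and>
     (\<forall>u. distr M borel (\<lambda>x. u \<bullet> x) = normal_law (u \<bullet> \<mu>) (u \<bullet> (A *v u)))"

section \<open>Ito stochastic differential equations on \<open>[0,T]\<close>\<close>

definition brownian_motion ::
  "'w measure \<Rightarrow> (real \<Rightarrow> 'w measure) \<Rightarrow> real \<Rightarrow> (real \<Rightarrow> 'w \<Rightarrow> real^'d) \<Rightarrow> bool" where
  "brownian_motion M F T W \<longleftrightarrow>
     prob_space M \<and>
     (\<forall>t\<in>{0..T}. subalgebra M (F t)) \<and>
     (\<forall>s t. 0 \<le> s \<and> s \<le> t \<and> t \<le> T \<longrightarrow> sets (F s) \<subseteq> sets (F t)) \<and>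
     (\<forall>t\<in>{0..T}. W t \<in> borel_measurable (F t)) \<and>
     (AE \<omega> in M. W 0 \<omega> = 0) \<and>
     (AE \<omega> in M. continuous_on {0..T} (\<lambda>t. W t \<omega>)) \<and>
     (\<forall>s t. 0 \<le> s \<and> s < t \<and> t \<le> T \<longrightarrow>
        gaussian_law 0 (mat (t - s)) (distr M borel (\<lambda>\<omega>. W t \<omega> - W s \<omega>)) \<and>
        prob_space.indep_set M (sets (F s))
          {(\<lambda>\<omega>. W t \<omega> - W s \<omega>) -` B \<inter> space M | B. B \<in> sets borel})"

text \<open>A simple integrand on \<open>(0,t]\<close> consists of a partition \<open>0 = p 0 \<le> \<dots> \<le> p m = t\<close> and bounded
  coefficients \<open>\<xi> i\<close>, measurable with respect to \<open>F (p i)\<close>, the value on \<open>(p i, p (i + 1)]\<close>.\<close>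

definition simple_integrand ::
  "'w measure \<Rightarrow> (real \<Rightarrow> 'w measure) \<Rightarrow> real \<Rightarrow> nat \<Rightarrow> (nat \<Rightarrow> real) \<Rightarrow>
   (nat \<Rightarrow> 'w \<Rightarrow> real^'d^'n) \<Rightarrow> bool" where
  "simple_integrand M F t m p \<xi> \<longleftrightarrow>
     p 0 = 0 \<and> p m = t \<and> (\<forall>i<m. p i \<le> p (Suc i)) \<and>
     (\<forall>i<m. \<xi> i \<in> borel_measurable (F (p i)) \<and> bounded (\<xi> i ` space M))"

definition simple_value ::
  "nat \<Rightarrow> (nat \<Rightarrow> real) \<Rightarrow> (nat \<Rightarrow> 'w \<Rightarrow> real^'d^'n) \<Rightarrow> real \<Rightarrow> 'w \<Rightarrow> real^'d^'n" where
  "simple_value m p \<xi> s \<omega> = (\<Sum>i<m. indicator {p i<..p (Suc i)} s *\<^sub>R \<xi> i \<omega>)"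

definition simple_integral ::
  "(real \<Rightarrow> 'w \<Rightarrow> real^'d) \<Rightarrow> nat \<Rightarrow> (nat \<Rightarrow> real) \<Rightarrow> (nat \<Rightarrow> 'w \<Rightarrow> real^'d^'n) \<Rightarrow>
   'w \<Rightarrow> real^'n" where
  "simple_integral W m p \<xi> \<omega> = (\<Sum>i<m. \<xi> i \<omega> *v (W (p (Suc i)) \<omega> - W (p i) \<omega>))"

text \<open>\<open>Z\<close> is (a version of) the Ito integral of \<open>H\<close> over \<open>[0,t]\<close>: the \<open>L\<^sup>2\<close> limit of integrals of
  simple integrands that approximate \<open>H\<close> in \<open>L\<^sup>2\<close>.\<close>

definition ito_integral ::
  "'w measure \<Rightarrow> (real \<Rightarrow> 'w measure) \<Rightarrow> (real \<Rightarrow> 'w \<Rightarrow> real^'d) \<Rightarrow>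
   (real \<Rightarrow> 'w \<Rightarrow> real^'d^'n) \<Rightarrow> real \<Rightarrow> ('w \<Rightarrow> real^'n) \<Rightarrow> bool" where
  "ito_integral M F W H t Z \<longleftrightarrow>
     Z \<in> borel_measurable M \<and>
     (\<exists>m p \<xi>.
        (\<forall>k. simple_integrand M F t (m k) (p k) (\<xi> k)) \<and>
        (\<lambda>k::nat. \<integral>\<^sup>+\<omega>. (\<integral>\<^sup>+s\<in>{0..t}. ennreal ((norm (H s \<omega> - simple_value (m k) (p k) (\<xi> k) s \<omega>))\<^sup>2)
            \<partial>lborel) \<partial>M) \<longlonglongrightarrow> 0 \<and>
        (\<lambda>k. \<integral>\<^sup>+\<omega>. ennreal ((norm (Z \<omega> - simple_integral W (m k) (p k) (\<xi> k) \<omega>))\<^sup>2) \<partial>M) \<longlonglongrightarrow> 0)"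

definition ito_solution ::
  "'w measure \<Rightarrow> (real \<Rightarrow> 'w measure) \<Rightarrow> real \<Rightarrow> (real \<Rightarrow> 'w \<Rightarrow> real^'d) \<Rightarrow>
   ((real^'n) \<times> real \<Rightarrow> real^'n) \<Rightarrow> ((real^'n) \<times> real \<Rightarrow> real^'d^'n) \<Rightarrow>
   (real \<Rightarrow> 'w \<Rightarrow> real^'n) \<Rightarrow> bool" where
  "ito_solution M F T W b \<sigma> X \<longleftrightarrow>
     (\<forall>t\<in>{0..T}. X t \<in> borel_measurable (F t)) \<and>
     (AE \<omega> in M. continuous_on {0..T} (\<lambda>t. X t \<omega>)) \<and>
     (\<forall>t\<in>{0..T}. \<exists>Z. ito_integral M F W (\<lambda>s \<omega>. \<sigma> (X s \<omega>, s)) t Z \<and>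
        (AE \<omega> in M. X t \<omega> = X 0 \<omega> + integral {0..t} (\<lambda>s. b (X s \<omega>, s)) + Z \<omega>))"

text \<open>The matrix \<open>\<Sigma> = \<sigma> \<sigma>\<^sup>T\<close>; \<open>real^'d^'n\<close> has \<open>n\<close> rows and \<open>d\<close> columns.\<close>

definition diffusion_matrix ::
  "((real^'n) \<times> real \<Rightarrow> real^'d^'n) \<Rightarrow> real^'n \<Rightarrow> real \<Rightarrow> real^'n^'n" where
  "diffusion_matrix \<sigma> x t = \<sigma> (x, t) ** transpose (\<sigma> (x, t))"

section \<open>Signed measures\<close>

text \<open>A real-valued countably additive set function on a \<open>\<sigma>\<close>-algebra is automatically bounded.\<close>

definition signed_measure :: "'a measure \<Rightarrow> ('a set \<Rightarrow> real) \<Rightarrow> bool" where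
  "signed_measure M \<nu> \<longleftrightarrow>
     \<nu> {} = 0 \<and>
     (\<forall>A::nat \<Rightarrow> 'a set. range A \<subseteq> sets M \<longrightarrow> disjoint_family A \<longrightarrow>
        (\<lambda>i. \<nu> (A i)) sums \<nu> (\<Union>i. A i))"

text \<open>The upper variation \<open>\<nu>\<^sup>+(A) = sup {\<nu> B | B \<subseteq> A}\<close>; \<^const>\<open>ennreal\<close> truncates negative values
  to \<open>0 = \<nu> {}\<close>. The lower variation is that of \<open>-\<nu>\<close>. The measure \<open>M\<close> only provides the
  \<open>\<sigma>\<close>-algebra.\<close>

definition upper_variation :: "'a measure \<Rightarrow> ('a set \<Rightarrow> real) \<Rightarrow> 'a measure" where
  "upper_variation M \<nu> =
     measure_of (space M) (sets M) (\<lambda>A. SUP B\<in>{B \<in> sets M. B \<subseteq> A}. ennreal (\<nu> B))"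

definition signed_integral :: "'a measure \<Rightarrow> ('a set \<Rightarrow> real) \<Rightarrow> ('a \<Rightarrow> real) \<Rightarrow> real" where
  "signed_integral M \<nu> f =
     (\<integral>x. f x \<partial>upper_variation M \<nu>) - (\<integral>x. f x \<partial>upper_variation M (\<lambda>A. - \<nu> A))"

definition weak_derivative ::
  "(real \<Rightarrow> (real^'n) measure) \<Rightarrow> real \<Rightarrow> ((real^'n) set \<Rightarrow> real) \<Rightarrow> bool" where
  "weak_derivative P \<theta> \<nu> \<longleftrightarrow>
     signed_measure borel \<nu> \<and>
     (\<forall>f::real^'n \<Rightarrow> real. smooth f \<and> bounded (range f) \<longrightarrow>
        ((\<lambda>\<eta>. \<integral>y. f y \<partial>P \<eta>) has_real_derivative signed_integral borel \<nu> f) (at \<theta>))"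

definition mutually_singular :: "'a measure \<Rightarrow> 'a measure \<Rightarrow> bool" where
  "mutually_singular M N \<longleftrightarrow>
     sets M = sets N \<and> (\<exists>S\<in>sets M. emeasure M (space M - S) = 0 \<and> emeasure N S = 0)"

text \<open>\<open>\<nu> = c (\<rho>\<^sup>+ - \<rho>\<^sup>-)\<close> with mutually singular probability measures. Since \<open>c \<ge> 0\<close>, the measures
  \<open>c \<rho>\<^sup>+\<close> and \<open>c \<rho>\<^sup>-\<close> are the Jordan components of \<open>\<nu>\<close>.\<close>

definition hahn_jordan_decomposition ::
  "'a measure \<Rightarrow> ('a set \<Rightarrow> real) \<Rightarrow> real \<Rightarrow> 'a measure \<Rightarrow> 'a measure \<Rightarrow> bool" where
  "hahn_jordan_decomposition M \<nu> c \<rho>p \<rho>m \<longleftrightarrow>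
     0 \<le> c \<and>
     prob_space \<rho>p \<and> sets \<rho>p = sets M \<and>
     prob_space \<rho>m \<and> sets \<rho>m = sets M \<and>
     mutually_singular \<rho>p \<rho>m \<and>
     (\<forall>A\<in>sets M. \<nu> A = c * (measure \<rho>p A - measure \<rho>m A))"

end

theory Submission
  imports Defs
begin

text \<open>Fix \<open>x\<close> and \<open>t\<close>, write \<open>m(\<eta>)\<close> for the mean of \<open>P\<^sub>\<eta>\<close> and put \<open>B = \<surd>h \<sigma>(x,t)\<close>. The covariance
  is \<open>B B\<^sup>T\<close>, so \<open>P\<^sub>\<eta>\<close> is the law of \<open>m(\<eta>) + B Z\<close> with \<open>Z\<close> standard Gaussian on \<open>\<real>\<^sup>d\<close>
  (\<open>gaussian_law_eq_distr\<close>). Working with \<open>Z\<close> instead of a density of \<open>P\<^sub>\<eta>\<close> treats singular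
  covariances on the same footing as invertible ones.

  Suppose that \<open>m\<close> is differentiable at \<open>\<theta>\<close> and that \<open>m(\<eta>) - m(\<theta>) = B a(\<eta>)\<close> with \<open>a\<close> differentiable.
  Then the integral of a bounded measurable \<open>f\<close> is \<open>E F(Z + a(\<eta>))\<close> with \<open>F z = f (m(\<theta>) + B z)\<close>, and by
  the Cameron--Martin formula a shift of \<open>Z\<close> by \<open>v\<close> only multiplies its law by the density
  \<open>exp (v \<bullet> z - |v|\<^sup>2/2)\<close>. The density differs from \<open>1 + v \<bullet> z\<close> by \<open>O(|v|\<^sup>2)\<close> in \<open>L\<^sup>1\<close>, so the
  integral is differentiable, with derivative \<open>E F(Z) (a'(\<theta>) \<bullet> Z)\<close>, an integral against a signed
  measure (\<open>affine_std_gaussian_derivative\<close>). If \<open>B B\<^sup>T\<close> is invertible then \<open>B\<close> is onto, and this proves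
  that the weak derivative exists whenever the drift is differentiable in \<open>\<theta>\<close>.

  Conversely let weak derivatives \<open>\<nu>\<^sub>\<theta>\<close> exist for all \<open>\<theta>\<close>. Testing with \<open>cos (u \<bullet> y + \<alpha>)\<close> shows that
  \<open>m\<close> is differentiable. If \<open>w\<close> is orthogonal to the range of \<open>B\<close> then \<open>w \<bullet> y\<close> is the constant
  \<open>w \<bullet> m(\<eta>)\<close> almost surely, and testing with \<open>cos (s w \<bullet> y + \<alpha>)\<close> for large \<open>s\<close> shows that
  \<open>w \<bullet> m\<close> has derivative \<open>0\<close>: otherwise these derivatives would grow like \<open>s\<close>, while the integrals
  against the finite signed measure \<open>\<nu>\<^sub>\<theta>\<close> stay bounded. So \<open>w \<bullet> m\<close> is constant, \<open>m(\<eta>) - m(\<theta>)\<close> lies in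
  the range of \<open>B\<close>, and the previous paragraph applies. It yields a signed measure that has the same
  integrals of cosines as \<open>\<nu>\<^sub>\<theta>\<close>, hence the same integrals of all bounded measurable functions
  (\<open>signed_integral_eqI_cos\<close>). Finally \<open>\<nu>\<^sub>\<theta>\<close> has total mass \<open>0\<close>, the derivative of the constant
  \<open>P\<^sub>\<eta>(\<real>\<^sup>n) = 1\<close>, so its two Jordan components have equal mass \<open>c\<close>. Dividing them by \<open>c\<close> gives
  the probability measures; if \<open>c = 0\<close>, any two mutually singular ones will do.\<close>

section \<open>Jordan decomposition of a signed measure\<close>

lemma signed_measure_Un:
  assumes \<nu>: "signed_measure M \<nu>" and A: "A \<in> sets M" and B: "B \<in> sets M" and d: "A \<inter> B = {}"
  shows "\<nu> (A \<union> B) = \<nu> A + \<nu> B"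
proof -
  have "range (binaryset A B) \<subseteq> sets M"
    using A B by (auto simp: range_binaryset_eq)
  moreover have "disjoint_family (binaryset A B)"
    using d by (auto simp: disjoint_family_on_def binaryset_def)
  ultimately have "(\<lambda>i. \<nu> (binaryset A B i)) sums \<nu> (\<Union>i. binaryset A B i)"
    using \<nu> unfolding signed_measure_def by blast
  moreover have "(\<lambda>i. \<nu> (binaryset A B i)) sums (\<nu> A + \<nu> B)"
    using \<nu> by (intro binaryset_sums) (auto simp: signed_measure_def)
  ultimately show ?thesis
    using sums_unique2 by (metis UN_binaryset_eq)
qed

lemma signed_measure_split:
  assumes "signed_measure M \<nu>" "A \<in> sets M" "B \<in> sets M"
  shows "\<nu> A = \<nu> (A \<inter> B) + \<nu> (A - B)"
  using signed_measure_Un[OF assms(1), of "A \<inter> B" "A - B"] assms(2,3)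
  by (metis Int_Diff_Un Int_Diff_disjoint sets.Diff sets.Int)

lemma signed_measure_uminus:
  "signed_measure M \<nu> \<Longrightarrow> signed_measure M (\<lambda>A. - \<nu> A)"
  unfolding signed_measure_def by (auto intro: sums_minus)

text \<open>Call a set bad if \<open>\<nu>\<close> is unbounded on its measurable subsets. A bad set splits into two parts of
  measure larger than \<open>1\<close> in absolute value, one of which is bad again. If the whole space were bad,
  peeling off the other parts would give disjoint sets whose measures do not tend to
  \<open>0\<close>, which contradicts the convergence of the series in countable additivity.\<close>

lemma signed_measure_bounded:
  assumes \<nu>: "signed_measure M \<nu>"
  obtains K where "\<And>A. A \<in> sets M \<Longrightarrow> \<bar>\<nu> A\<bar> \<le> K"
proof -
  define bad where
    "bad E \<longleftrightarrow> E \<in> sets M \<and> (\<forall>K. \<exists>A\<in>sets M. A \<subseteq> E \<and> \<bar>\<nu> A\<bar> > K)" for E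
  have step: "\<exists>E'. bad E' \<and> E' \<subseteq> E \<and> \<bar>\<nu> (E - E')\<bar> > 1" if E: "bad E" for E
  proof -
    have Es: "E \<in> sets M" using E by (simp add: bad_def)
    obtain A where A: "A \<in> sets M" "A \<subseteq> E" "\<bar>\<nu> A\<bar> > 1 + \<bar>\<nu> E\<bar>"
      using E unfolding bad_def by blast
    have AE: "\<nu> E = \<nu> A + \<nu> (E - A)"
      using signed_measure_split[OF \<nu> Es A(1)] A(2) by (simp add: Int_absorb1)
    then have B: "\<bar>\<nu> (E - A)\<bar> > 1" using A(3) by linarith
    have "bad A \<or> bad (E - A)"
    proof (rule ccontr)
      assume "\<not> (bad A \<or> bad (E - A))"
      then obtain K1 K2 where
        K1: "\<And>C. C \<in> sets M \<Longrightarrow> C \<subseteq> A \<Longrightarrow> \<bar>\<nu> C\<bar> \<le> K1" and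
        K2: "\<And>C. C \<in> sets M \<Longrightarrow> C \<subseteq> E - A \<Longrightarrow> \<bar>\<nu> C\<bar> \<le> K2"
        using A(1) Es unfolding bad_def by (meson not_less sets.Diff)
      obtain C where C: "C \<in> sets M" "C \<subseteq> E" "\<bar>\<nu> C\<bar> > K1 + K2"
        using E unfolding bad_def by blast
      have "\<nu> C = \<nu> (C \<inter> A) + \<nu> (C - A)"
        by (rule signed_measure_split[OF \<nu> C(1) A(1)])
      moreover have "\<bar>\<nu> (C \<inter> A)\<bar> \<le> K1" "\<bar>\<nu> (C - A)\<bar> \<le> K2"
        using K1[of "C \<inter> A"] K2[of "C - A"] C A(1) by auto
      ultimately show False using C(3) by linarith
    qed
    then show ?thesis
    proof
      assume "bad A"
      then show ?thesis using A(2) B by blast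
    next
      assume "bad (E - A)"
      moreover have "E - (E - A) = A" using A(2) by auto
      moreover have "\<bar>\<nu> A\<bar> > 1" using A(3) by linarith
      ultimately show ?thesis by (metis Diff_subset)
    qed
  qed
  have "\<not> bad (space M)"
  proof
    assume "bad (space M)"
    then have "\<exists>E. \<forall>n. bad (E n) \<and> E (Suc n) \<subseteq> E n \<and> \<bar>\<nu> (E n - E (Suc n))\<bar> > 1"
      using step by (intro dependent_nat_choice) blast+
    then obtain E where E: "\<And>n. bad (E n)" "\<And>n. E (Suc n) \<subseteq> E n \<and> \<bar>\<nu> (E n - E (Suc n))\<bar> > 1"
      by blast
    have anti: "E m \<subseteq> E n" if "n \<le> m" for n m
      using E(2) by (intro lift_Suc_antimono_le[OF _ that]) auto
    have "disjoint_family (\<lambda>n. E n - E (Suc n))"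
    proof (unfold disjoint_family_on_def, intro ballI impI)
      fix m n :: nat assume "m \<noteq> n"
      then consider "Suc m \<le> n" | "Suc n \<le> m" by linarith
      then show "(E m - E (Suc m)) \<inter> (E n - E (Suc n)) = {}"
        by cases (use anti in blast)+
    qed
    moreover have "range (\<lambda>n. E n - E (Suc n)) \<subseteq> sets M"
      using E(1) by (auto simp: bad_def)
    ultimately have "(\<lambda>n. \<nu> (E n - E (Suc n))) sums \<nu> (\<Union>n. E n - E (Suc n))"
      using \<nu> unfolding signed_measure_def by blast
    then have "(\<lambda>n. \<nu> (E n - E (Suc n))) \<longlonglongrightarrow> 0"
      using sums_summable summable_LIMSEQ_zero by blast
    from tendstoD[OF this zero_less_one] obtain n where "\<bar>\<nu> (E n - E (Suc n))\<bar> < 1"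
      by (auto simp: eventually_sequentially)
    then show False using E(2)[of n] by linarith
  qed
  then obtain K where "\<And>A. A \<in> sets M \<Longrightarrow> A \<subseteq> space M \<Longrightarrow> \<bar>\<nu> A\<bar> \<le> K"
    unfolding bad_def by (auto simp: not_less)
  then show thesis
    using that[of K] sets.sets_into_space by blast
qed

text \<open>The set function in the definition of \<^const>\<open>upper_variation\<close> is countably additive, so that the
  measure built from it takes these values. Superadditivity comes from uniting subsets of the parts,
  subadditivity from cutting a subset of the union along the parts.\<close>

lemma upper_variation_measure:
  assumes \<nu>: "signed_measure M \<nu>"
  shows space_upper_variation: "space (upper_variation M \<nu>) = space M"
    and sets_upper_variation: "sets (upper_variation M \<nu>) = sets M"
    and emeasure_upper_variation: "A \<in> sets M \<Longrightarrow>
      emeasure (upper_variation M \<nu>) A = (SUP B\<in>{B \<in> sets M. B \<subseteq> A}. ennreal (\<nu> B))"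
proof -
  define V where "V A = (SUP B\<in>{B \<in> sets M. B \<subseteq> A}. ennreal (\<nu> B))" for A
  show "space (upper_variation M \<nu>) = space M" "sets (upper_variation M \<nu>) = sets M"
    by (simp_all add: upper_variation_def)
  have \<nu>0: "\<nu> {} = 0" using \<nu> by (simp add: signed_measure_def)
  have mono: "V A \<le> V B" if "A \<subseteq> B" for A B
    unfolding V_def using that by (intro SUP_subset_mono) auto
  have V0: "V {} = 0"
  proof -
    have "{B \<in> sets M. B \<subseteq> {}} = {{}}" by auto
    then show ?thesis using \<nu>0 by (simp add: V_def)
  qed
  have le: "ennreal (\<nu> B) \<le> V A" if "B \<in> sets M" "B \<subseteq> A" for A B
    unfolding V_def using that by (intro SUP_upper) auto
  have super: "V A + V B \<le> V (A \<union> B)" if AB: "A \<inter> B = {}" for A B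
  proof -
    have "ennreal (\<nu> C) + ennreal (\<nu> D) \<le> V (A \<union> B)"
      if C: "C \<in> sets M" "C \<subseteq> A" and D: "D \<in> sets M" "D \<subseteq> B" for C D
    proof -
      \<comment> \<open>A set of negative measure contributes \<open>0\<close> to the supremum and is dropped from the union.\<close>
      consider "\<nu> C \<le> 0" | "\<nu> D \<le> 0" | "\<nu> C \<ge> 0" "\<nu> D \<ge> 0" by linarith
      then show ?thesis
      proof cases
        case 1 then show ?thesis using le[OF D(1), of "A \<union> B"] D(2) by (simp add: ennreal_neg le_supI2)
      next
        case 2 then show ?thesis using le[OF C(1), of "A \<union> B"] C(2) by (simp add: ennreal_neg le_supI1)
      next
        case 3
        have "\<nu> (C \<union> D) = \<nu> C + \<nu> D" using C D AB by (intro signed_measure_Un[OF \<nu>]) auto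
        then have "ennreal (\<nu> C) + ennreal (\<nu> D) = ennreal (\<nu> (C \<union> D))"
          using 3 by simp
        also have "\<dots> \<le> V (A \<union> B)" using C D by (intro le) auto
        finally show ?thesis .
      qed
    qed
    note bound = this
    have ne: "{C \<in> sets M. C \<subseteq> E} \<noteq> {}" for E by auto
    have "V A + V B = (SUP C\<in>{C \<in> sets M. C \<subseteq> A}. ennreal (\<nu> C) + V B)"
      unfolding V_def[of A] by (rule ennreal_SUP_add_left[OF ne, symmetric])
    also have "\<dots> \<le> V (A \<union> B)"
    proof (rule SUP_least)
      fix C assume C: "C \<in> {C \<in> sets M. C \<subseteq> A}"
      have "ennreal (\<nu> C) + V B = (SUP D\<in>{D \<in> sets M. D \<subseteq> B}. ennreal (\<nu> C) + ennreal (\<nu> D))"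
        unfolding V_def[of B] by (rule ennreal_SUP_add_right[OF ne])
      also have "\<dots> \<le> V (A \<union> B)" using C by (intro SUP_least) (auto intro: bound)
      finally show "ennreal (\<nu> C) + V B \<le> V (A \<union> B)" .
    qed
    finally show ?thesis .
  qed
  have "countably_additive (sets M) V"
  proof (unfold countably_additive_def, intro allI impI)
    fix A :: "nat \<Rightarrow> _" assume A: "range A \<subseteq> sets M" "disjoint_family A" "(\<Union>i. A i) \<in> sets M"
    show "(\<Sum>i. V (A i)) = V (\<Union>i. A i)"
    proof (rule antisym)
      have fin: "(\<Sum>i<n. V (A i)) \<le> V (\<Union>i<n. A i)" for n
      proof (induction n)
        case 0 then show ?case by simp
      next
        case (Suc n)
        have "(\<Sum>i<Suc n. V (A i)) \<le> V (\<Union>i<n. A i) + V (A n)"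
          using add_right_mono[OF Suc] by simp
        also have "\<dots> \<le> V ((\<Union>i<n. A i) \<union> A n)"
        proof (rule super)
          have "A i \<inter> A n = {}" if "i < n" for i
            using disjoint_family_onD[OF A(2)] that by simp
          then show "(\<Union>i<n. A i) \<inter> A n = {}" by blast
        qed
        also have "(\<Union>i<n. A i) \<union> A n = (\<Union>i<Suc n. A i)" by (auto simp: less_Suc_eq)
        finally show ?case .
      qed
      show "(\<Sum>i. V (A i)) \<le> V (\<Union>i. A i)"
      proof (rule suminf_le_const[OF summableI])
        fix n
        have "V (\<Union>i<n. A i) \<le> V (\<Union>i. A i)" by (rule mono) auto
        with fin show "(\<Sum>i<n. V (A i)) \<le> V (\<Union>i. A i)" by (rule order_trans)
      qed
      show "V (\<Union>i. A i) \<le> (\<Sum>i. V (A i))"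
        unfolding V_def[of "\<Union>i. A i"]
      proof (rule SUP_least)
        fix B assume "B \<in> {B \<in> sets M. B \<subseteq> (\<Union>i. A i)}"
        then have B: "B \<in> sets M" "(\<Union>i. B \<inter> A i) = B" by blast+
        have "range (\<lambda>i. B \<inter> A i) \<subseteq> sets M" using B(1) A(1) by auto
        moreover have "disjoint_family (\<lambda>i. B \<inter> A i)"
          using A(2) by (auto simp: disjoint_family_on_def)
        ultimately have "(\<lambda>i. \<nu> (B \<inter> A i)) sums \<nu> (\<Union>i. B \<inter> A i)"
          using \<nu> unfolding signed_measure_def by blast
        then have "(\<lambda>i. \<nu> (B \<inter> A i)) sums \<nu> B" unfolding B(2) .
        then have lim: "(\<lambda>n. ennreal (\<Sum>i<n. \<nu> (B \<inter> A i))) \<longlonglongrightarrow> ennreal (\<nu> B)"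
          unfolding sums_def by (rule tendsto_ennrealI)
        have part: "ennreal (\<Sum>i<n. \<nu> (B \<inter> A i)) \<le> (\<Sum>i<n. V (A i))" for n
        proof -
          have "ennreal (\<Sum>i<n. \<nu> (B \<inter> A i)) \<le> ennreal (\<Sum>i<n. max 0 (\<nu> (B \<inter> A i)))"
            by (intro ennreal_leI sum_mono) auto
          also have "\<dots> = (\<Sum>i<n. ennreal (max 0 (\<nu> (B \<inter> A i))))"
            by (rule sum_ennreal[symmetric]) auto
          also have "\<dots> = (\<Sum>i<n. ennreal (\<nu> (B \<inter> A i)))" by simp
          also have "\<dots> \<le> (\<Sum>i<n. V (A i))"
            using A(1) B(1) by (intro sum_mono le) auto
          finally show ?thesis .
        qed
        have "ennreal (\<Sum>i<n. \<nu> (B \<inter> A i)) \<le> (\<Sum>i. V (A i))" for n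
          using part by (rule order_trans) (auto intro!: sum_le_suminf)
        then show "ennreal (\<nu> B) \<le> (\<Sum>i. V (A i))"
          by (intro LIMSEQ_le_const2[OF lim] exI allI impI)
      qed
    qed
  qed
  moreover have "positive (sets M) V" using V0 by (simp add: positive_def)
  moreover have "upper_variation M \<nu> = measure_of (space M) (sets M) V"
    unfolding upper_variation_def V_def ..
  ultimately show "emeasure (upper_variation M \<nu>) A =
      (SUP B\<in>{B \<in> sets M. B \<subseteq> A}. ennreal (\<nu> B))" if "A \<in> sets M"
    using emeasure_measure_of_sigma[OF sets.sigma_algebra_axioms, of M V A] that
    by (simp add: V_def)
qed

lemma finite_measure_upper_variation:
  assumes \<nu>: "signed_measure M \<nu>"
  shows "finite_measure (upper_variation M \<nu>)"
proof
  obtain K where K: "\<And>A. A \<in> sets M \<Longrightarrow> \<bar>\<nu> A\<bar> \<le> K"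
    using signed_measure_bounded[OF \<nu>] by blast
  have "emeasure (upper_variation M \<nu>) (space M) \<le> ennreal K"
    unfolding emeasure_upper_variation[OF \<nu> sets.top]
    by (intro SUP_least ennreal_leI) (use K in \<open>auto simp: abs_le_iff\<close>)
  then show "emeasure (upper_variation M \<nu>) (space (upper_variation M \<nu>)) \<noteq> \<infinity>"
    by (auto simp: space_upper_variation[OF \<nu>] top_unique)
qed

lemma le_upper_variation:
  assumes \<nu>: "signed_measure M \<nu>" and "A \<in> sets M" "B \<in> sets M" "B \<subseteq> A"
  shows "\<nu> B \<le> measure (upper_variation M \<nu>) A"
proof -
  interpret finite_measure "upper_variation M \<nu>" by (rule finite_measure_upper_variation[OF \<nu>])
  have "ennreal (\<nu> B) \<le> emeasure (upper_variation M \<nu>) A"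
    unfolding emeasure_upper_variation[OF \<nu> assms(2)] using assms by (intro SUP_upper) auto
  then show ?thesis by (simp add: emeasure_eq_measure)
qed

lemma upper_variation_least:
  assumes \<nu>: "signed_measure M \<nu>" and "A \<in> sets M"
    and "\<And>B. B \<in> sets M \<Longrightarrow> B \<subseteq> A \<Longrightarrow> \<nu> B \<le> q"
  shows "measure (upper_variation M \<nu>) A \<le> q"
proof -
  interpret finite_measure "upper_variation M \<nu>" by (rule finite_measure_upper_variation[OF \<nu>])
  have "0 \<le> q" using assms(3)[of "{}"] \<nu> by (simp add: signed_measure_def)
  moreover have "emeasure (upper_variation M \<nu>) A \<le> ennreal q"
    unfolding emeasure_upper_variation[OF \<nu> assms(2)] using assms(3)
    by (intro SUP_least ennreal_leI) auto
  ultimately show ?thesis by (simp add: emeasure_eq_measure)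
qed

text \<open>Passing from \<open>B\<close> to \<open>A - B\<close> turns the supremum of \<open>\<nu> B\<close> over \<open>B \<subseteq> A\<close> into \<open>\<nu> A\<close> plus the supremum of
  \<open>-\<nu> B\<close>; the difference makes sense because both are finite.\<close>

lemma jordan_decomposition:
  assumes \<nu>: "signed_measure M \<nu>" and A: "A \<in> sets M"
  shows "\<nu> A = measure (upper_variation M \<nu>) A - measure (upper_variation M (\<lambda>A. - \<nu> A)) A"
    (is "_ = ?p - ?m")
proof -
  have \<nu>': "signed_measure M (\<lambda>A. - \<nu> A)" by (rule signed_measure_uminus[OF \<nu>])
  have split: "\<nu> A = \<nu> B + \<nu> (A - B)" if "B \<in> sets M" "B \<subseteq> A" for B
    using signed_measure_split[OF \<nu> A that(1)] that(2) by (simp add: Int_absorb1)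
  have "?p \<le> \<nu> A + ?m"
  proof (rule upper_variation_least[OF \<nu> A])
    fix B assume B: "B \<in> sets M" "B \<subseteq> A"
    have "- \<nu> (A - B) \<le> ?m" using A B by (intro le_upper_variation[OF \<nu>']) auto
    then show "\<nu> B \<le> \<nu> A + ?m" using split[OF B] by simp
  qed
  moreover have "?m \<le> ?p - \<nu> A"
  proof (rule upper_variation_least[OF \<nu>' A])
    fix B assume B: "B \<in> sets M" "B \<subseteq> A"
    have "\<nu> (A - B) \<le> ?p" using A B by (intro le_upper_variation[OF \<nu>]) auto
    then show "- \<nu> B \<le> ?p - \<nu> A" using split[OF B] by simp
  qed
  ultimately show ?thesis by simp
qed

text \<open>A Hahn set of the two upper variations separates them: on its complement \<open>\<nu>\<close> is nowhere positive
  and so has upper variation \<open>0\<close>, and on the set itself the same holds for \<open>-\<nu>\<close>.\<close>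

lemma upper_variations_mutually_singular:
  assumes \<nu>: "signed_measure M \<nu>"
  shows "mutually_singular (upper_variation M \<nu>) (upper_variation M (\<lambda>A. - \<nu> A))"
    (is "mutually_singular ?p ?m")
proof -
  have \<nu>': "signed_measure M (\<lambda>A. - \<nu> A)" by (rule signed_measure_uminus[OF \<nu>])
  interpret p: finite_measure ?p by (rule finite_measure_upper_variation[OF \<nu>])
  interpret m: finite_measure ?m by (rule finite_measure_upper_variation[OF \<nu>'])
  have sp: "sets ?p = sets M" "space ?p = space M" and sm: "sets ?m = sets M" "space ?m = space M"
    by (simp_all add: sets_upper_variation space_upper_variation \<nu> \<nu>')
  have "\<exists>Y\<in>sets ?p. (\<forall>X\<in>sets ?p. X \<subseteq> Y \<longrightarrow> emeasure ?m X \<le> emeasure ?p X) \<and>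
      (\<forall>X\<in>sets ?p. X \<inter> Y = {} \<longrightarrow> emeasure ?p X \<le> emeasure ?m X)"
    by (rule finite_unsigned_Hahn_decomposition)
      (simp_all add: sp sm p.finite_measure_axioms m.finite_measure_axioms)
  then obtain S where "S \<in> sets ?p"
    and "\<forall>X\<in>sets ?p. X \<subseteq> S \<longrightarrow> emeasure ?m X \<le> emeasure ?p X"
    and "\<forall>X\<in>sets ?p. X \<inter> S = {} \<longrightarrow> emeasure ?p X \<le> emeasure ?m X"
    by (elim bexE conjE) (rule that)
  then have S: "S \<in> sets M"
    and pos: "\<And>X. X \<in> sets M \<Longrightarrow> X \<subseteq> S \<Longrightarrow> emeasure ?m X \<le> emeasure ?p X"
    and neg: "\<And>X. X \<in> sets M \<Longrightarrow> X \<inter> S = {} \<Longrightarrow> emeasure ?p X \<le> emeasure ?m X"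
    by (simp_all add: sp)
  have "measure ?p (space M - S) \<le> 0"
  proof (rule upper_variation_least[OF \<nu>])
    fix B assume B: "B \<in> sets M" "B \<subseteq> space M - S"
    then have "emeasure ?p B \<le> emeasure ?m B" by (intro neg) auto
    then show "\<nu> B \<le> 0" using jordan_decomposition[OF \<nu> B(1)]
      by (simp add: p.emeasure_eq_measure m.emeasure_eq_measure)
  qed (use S in auto)
  moreover have "measure ?m S \<le> 0"
  proof (rule upper_variation_least[OF \<nu>' S])
    fix B assume B: "B \<in> sets M" "B \<subseteq> S"
    then have "emeasure ?m B \<le> emeasure ?p B" by (intro pos) auto
    then show "- \<nu> B \<le> 0" using jordan_decomposition[OF \<nu> B(1)]
      by (simp add: p.emeasure_eq_measure m.emeasure_eq_measure)
  qed
  ultimately have "emeasure ?p (space ?p - S) = 0" "emeasure ?m S = 0"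
    by (simp_all add: sp p.emeasure_eq_measure m.emeasure_eq_measure measure_le_0_iff)
  then show ?thesis
    unfolding mutually_singular_def using S sp sm by auto
qed

section \<open>Integration against a signed measure\<close>

text \<open>Identities between differences of measures are proved as identities between sums, to which
  uniqueness theorems for positive measures apply.\<close>

definition sum_measure :: "'a measure \<Rightarrow> 'a measure \<Rightarrow> 'a measure" where
  "sum_measure M N = measure_of (space M) (sets M) (\<lambda>A. emeasure M A + emeasure N A)"

lemma space_sum_measure: "space (sum_measure M N) = space M"
  and sets_sum_measure [measurable_cong]: "sets (sum_measure M N) = sets M"
  by (simp_all add: sum_measure_def)

lemma emeasure_sum_measure:
  assumes N: "sets N = sets M" and A: "A \<in> sets M"
  shows "emeasure (sum_measure M N) A = emeasure M A + emeasure N A"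
  unfolding sum_measure_def
proof (rule emeasure_measure_of_sigma[OF sets.sigma_algebra_axioms _ _ A])
  show "countably_additive (sets M) (\<lambda>A. emeasure M A + emeasure N A)"
  proof (unfold countably_additive_def, intro allI impI)
    fix A :: "nat \<Rightarrow> _" assume "range A \<subseteq> sets M" "disjoint_family A"
    then show "(\<Sum>i. emeasure M (A i) + emeasure N (A i)) = emeasure M (\<Union>i. A i) + emeasure N (\<Union>i. A i)"
      by (simp add: suminf_add[symmetric] suminf_emeasure N)
  qed
qed (simp add: positive_def)

lemma nn_integral_sum_measure:
  assumes N: "sets N = sets M" and f: "f \<in> borel_measurable M"
  shows "(\<integral>\<^sup>+x. f x \<partial>sum_measure M N) = (\<integral>\<^sup>+x. f x \<partial>M) + (\<integral>\<^sup>+x. f x \<partial>N)"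
  using f
proof induction
  case (cong f g)
  then show ?case
    by (simp add: space_sum_measure sets_eq_imp_space_eq[OF N] cong: nn_integral_cong_simp)
next
  case (set A)
  then show ?case by (simp add: N sets_sum_measure emeasure_sum_measure)
next
  case (mult u c)
  then have "u \<in> borel_measurable N" "u \<in> borel_measurable (sum_measure M N)"
    by (simp_all add: N sets_sum_measure cong: measurable_cong_sets)
  with mult show ?case by (simp add: nn_integral_cmult distrib_left)
next
  case (add u v)
  then have "u \<in> borel_measurable N" "u \<in> borel_measurable (sum_measure M N)"
    "v \<in> borel_measurable N" "v \<in> borel_measurable (sum_measure M N)"
    by (simp_all add: N sets_sum_measure cong: measurable_cong_sets)
  with add show ?case by (simp add: nn_integral_add ac_simps)
next
  case (seq U)
  then have "\<And>i. U i \<in> borel_measurable N" "\<And>i. U i \<in> borel_measurable (sum_measure M N)"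
    by (simp_all add: N sets_sum_measure cong: measurable_cong_sets)
  moreover have "incseq (\<lambda>i. integral\<^sup>N K (U i))" for K
    using seq(3) by (auto simp: incseq_def le_fun_def intro!: nn_integral_mono)
  ultimately show ?case using seq
    by (simp add: nn_integral_monotone_convergence_SUP ennreal_SUP_add image_comp)
qed

lemma finite_measure_sum_measure:
  assumes "finite_measure M" "finite_measure N" and N: "sets N = sets M"
  shows "finite_measure (sum_measure M N)"
proof
  interpret M: finite_measure M by fact
  interpret N: finite_measure N by fact
  show "emeasure (sum_measure M N) (space (sum_measure M N)) \<noteq> \<infinity>"
    using sets_eq_imp_space_eq[OF N]
    by (simp add: space_sum_measure emeasure_sum_measure[OF N] M.emeasure_eq_measure N.emeasure_eq_measure)
qed

lemma integral_sum_measure: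
  fixes f :: "'a \<Rightarrow> real"
  assumes "finite_measure M" "finite_measure N" and N: "sets N = sets M"
    and f: "f \<in> borel_measurable M" and bnd: "\<And>x. \<bar>f x\<bar> \<le> K"
  shows "(\<integral>x. f x \<partial>sum_measure M N) = (\<integral>x. f x \<partial>M) + (\<integral>x. f x \<partial>N)"
proof -
  interpret M: finite_measure M by fact
  interpret N: finite_measure N by fact
  interpret S: finite_measure "sum_measure M N" by (rule finite_measure_sum_measure) fact+
  have fN: "f \<in> borel_measurable N" and fS: "f \<in> borel_measurable (sum_measure M N)"
    using f by (simp_all add: sets_sum_measure N cong: measurable_cong_sets)
  have nn: "0 \<le> f x + K" for x using bnd[of x] by linarith
  have shift: "(\<integral>x. f x + K \<partial>L) = enn2real (\<integral>\<^sup>+x. ennreal (f x + K) \<partial>L)"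
    if "f \<in> borel_measurable L" for L
    using that nn by (intro integral_eq_nn_integral) auto
  have int: "integrable L f" if "finite_measure L" "f \<in> borel_measurable L" for L
    using that(1) by (rule finite_measure.integrable_const_bound[where B=K]) (use that bnd in auto)
  have fin: "(\<integral>\<^sup>+x. ennreal (f x + K) \<partial>L) < \<infinity>"
    if "finite_measure L" "f \<in> borel_measurable L" for L
  proof -
    interpret finite_measure L by fact
    have "integrable L (\<lambda>x. f x + K)" using int[OF that] by simp
    then show ?thesis
      using nn by (subst nn_integral_eq_integral) auto
  qed
  have tot: "measure (sum_measure M N) (space (sum_measure M N)) = measure M (space M) + measure N (space N)"
    using sets_eq_imp_space_eq[OF N] emeasure_sum_measure[OF N sets.top]
    by (simp add: space_sum_measure S.emeasure_eq_measure M.emeasure_eq_measure N.emeasure_eq_measure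
        flip: ennreal_plus)
  have m: "(\<lambda>x. ennreal (f x + K)) \<in> borel_measurable M" using f by measurable
  have "(\<integral>x. f x + K \<partial>sum_measure M N) = (\<integral>x. f x + K \<partial>M) + (\<integral>x. f x + K \<partial>N)"
    using fin[OF assms(1) f] fin[OF assms(2) fN]
    by (simp add: shift f fN fS nn_integral_sum_measure[OF N m] enn2real_plus)
  then show ?thesis
    using int[OF assms(1) f] int[OF assms(2) fN] int[OF S.finite_measure_axioms fS] tot
    by (simp add: algebra_simps)
qed

text \<open>A signed measure determines the integrals of bounded functions, in whichever way it is written
  as a difference of finite measures.\<close>

lemma integral_difference_cong:
  fixes f :: "'a \<Rightarrow> real"
  assumes fin: "finite_measure p" "finite_measure q" "finite_measure p'" "finite_measure q'"
    and sets: "sets p = sets M" "sets q = sets M" "sets p' = sets M" "sets q' = sets M"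
    and eq: "\<And>A. A \<in> sets M \<Longrightarrow> measure p A - measure q A = measure p' A - measure q' A"
    and f: "f \<in> borel_measurable M" "bounded (range f)"
  shows "(\<integral>x. f x \<partial>p) - (\<integral>x. f x \<partial>q) = (\<integral>x. f x \<partial>p') - (\<integral>x. f x \<partial>q')"
proof -
  obtain K where K: "\<And>x. \<bar>f x\<bar> \<le> K" using f(2) by (auto simp: bounded_iff)
  have "sum_measure p q' = sum_measure p' q"
  proof (rule measure_eqI)
    fix A assume "A \<in> sets (sum_measure p q')"
    then have A: "A \<in> sets M" by (simp add: sets_sum_measure sets)
    have "measure p A + measure q' A = measure p' A + measure q A" using eq[OF A] by linarith
    then show "emeasure (sum_measure p q') A = emeasure (sum_measure p' q) A"
      using A fin by (simp add: emeasure_sum_measure sets finite_measure.emeasure_eq_measure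
          flip: ennreal_plus)
  qed (simp add: sets_sum_measure sets)
  moreover have "(\<integral>x. f x \<partial>sum_measure p q') = (\<integral>x. f x \<partial>p) + (\<integral>x. f x \<partial>q')"
    "(\<integral>x. f x \<partial>sum_measure p' q) = (\<integral>x. f x \<partial>p') + (\<integral>x. f x \<partial>q)"
    by (rule integral_sum_measure[where K=K]; use fin f(1) K in \<open>simp add: sets cong: measurable_cong_sets\<close>)+
  ultimately show ?thesis by simp
qed

lemma signed_measure_difference:
  assumes fin: "finite_measure p" "finite_measure q"
    and sets: "sets p = sets M" "sets q = sets M"
    and eq: "\<And>A. A \<in> sets M \<Longrightarrow> \<nu> A = measure p A - measure q A"
  shows "signed_measure M \<nu>"
  unfolding signed_measure_def
proof (intro conjI allI impI)
  show "\<nu> {} = 0" by (simp add: eq)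
  fix A :: "nat \<Rightarrow> _" assume A: "range A \<subseteq> sets M" "disjoint_family A"
  then have "(\<lambda>i. measure p (A i) - measure q (A i)) sums (measure p (\<Union>i. A i) - measure q (\<Union>i. A i))"
    by (intro sums_diff finite_measure.finite_measure_UNION) (simp_all add: fin sets)
  then show "(\<lambda>i. \<nu> (A i)) sums \<nu> (\<Union>i. A i)"
    using A by (subst (1 2) eq) (auto intro!: sets.countable_UN simp: image_subset_iff)
qed

lemma signed_integral_difference:
  assumes fin: "finite_measure p" "finite_measure q"
    and sets: "sets p = sets M" "sets q = sets M"
    and eq: "\<And>A. A \<in> sets M \<Longrightarrow> \<nu> A = measure p A - measure q A"
    and f: "f \<in> borel_measurable M" "bounded (range f)"
  shows "signed_integral M \<nu> f = (\<integral>x. f x \<partial>p) - (\<integral>x. f x \<partial>q)"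
  unfolding signed_integral_def
proof (rule integral_difference_cong[OF _ _ fin _ _ sets _ f])
  have \<nu>: "signed_measure M \<nu>" by (rule signed_measure_difference[OF fin sets eq])
  note \<nu>' = signed_measure_uminus[OF \<nu>]
  show "finite_measure (upper_variation M \<nu>)" "finite_measure (upper_variation M (\<lambda>A. - \<nu> A))"
    "sets (upper_variation M \<nu>) = sets M" "sets (upper_variation M (\<lambda>A. - \<nu> A)) = sets M"
    by (simp_all add: finite_measure_upper_variation sets_upper_variation \<nu> \<nu>')
  show "measure (upper_variation M \<nu>) A - measure (upper_variation M (\<lambda>A. - \<nu> A)) A =
      measure p A - measure q A" if "A \<in> sets M" for A
    using jordan_decomposition[OF \<nu> that] eq[OF that] by simp
qed

lemma signed_integral_abs_le:
  assumes \<nu>: "signed_measure M \<nu>"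
  obtains C where "\<And>f. f \<in> borel_measurable M \<Longrightarrow> (\<And>x. \<bar>f x\<bar> \<le> 1) \<Longrightarrow> \<bar>signed_integral M \<nu> f\<bar> \<le> C"
proof -
  have bnd: "\<bar>\<integral>x. f x \<partial>L\<bar> \<le> measure L (space L)"
    if "finite_measure L" "f \<in> borel_measurable L" "\<And>x. \<bar>f x\<bar> \<le> 1" for L and f :: "'a \<Rightarrow> real"
  proof -
    interpret finite_measure L by fact
    have i: "integrable L f" using that by (intro integrable_const_bound[where B=1]) auto
    have "\<bar>\<integral>x. f x \<partial>L\<bar> \<le> (\<integral>x. \<bar>f x\<bar> \<partial>L)" by (rule integral_abs_bound)
    also have "\<dots> \<le> (\<integral>x. 1 \<partial>L)" using i that(3) by (intro integral_mono) auto
    finally show ?thesis by simp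
  qed
  note \<nu>' = signed_measure_uminus[OF \<nu>]
  show thesis
  proof (rule that)
    fix f :: "'a \<Rightarrow> real" assume f: "f \<in> borel_measurable M" "\<And>x. \<bar>f x\<bar> \<le> 1"
    have "\<bar>\<integral>x. f x \<partial>upper_variation M \<nu>\<bar> \<le> measure (upper_variation M \<nu>) (space M)"
      "\<bar>\<integral>x. f x \<partial>upper_variation M (\<lambda>A. - \<nu> A)\<bar> \<le> measure (upper_variation M (\<lambda>A. - \<nu> A)) (space M)"
      using bnd[OF finite_measure_upper_variation[OF \<nu>], of f]
        bnd[OF finite_measure_upper_variation[OF \<nu>'], of f] f
      by (simp_all add: space_upper_variation sets_upper_variation \<nu> \<nu>' cong: measurable_cong_sets)
    then show "\<bar>signed_integral M \<nu> f\<bar> \<le> measure (upper_variation M \<nu>) (space M) +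
        measure (upper_variation M (\<lambda>A. - \<nu> A)) (space M)"
      unfolding signed_integral_def by linarith
  qed
qed

text \<open>Total mass zero makes the two Jordan components equally heavy, so that the same constant \<open>c\<close>
  normalizes both.\<close>

lemma ex_hahn_jordan_decomposition:
  fixes \<nu> :: "'a::euclidean_space set \<Rightarrow> real"
  assumes \<nu>: "signed_measure borel \<nu>" and zero: "\<nu> UNIV = 0"
  obtains c \<rho>p \<rho>m where "hahn_jordan_decomposition borel \<nu> c \<rho>p \<rho>m"
proof -
  let ?p = "upper_variation borel \<nu>" and ?m = "upper_variation borel (\<lambda>A. - \<nu> A)"
  note \<nu>' = signed_measure_uminus[OF \<nu>]
  interpret p: finite_measure ?p by (rule finite_measure_upper_variation[OF \<nu>])
  interpret m: finite_measure ?m by (rule finite_measure_upper_variation[OF \<nu>'])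
  have sp: "sets ?p = sets borel" "space ?p = UNIV" and sm: "sets ?m = sets borel" "space ?m = UNIV"
    using sets_upper_variation[OF \<nu>] space_upper_variation[OF \<nu>]
      sets_upper_variation[OF \<nu>'] space_upper_variation[OF \<nu>'] by auto
  define c where "c = measure ?p UNIV"
  have c: "measure ?p UNIV = c" "measure ?m UNIV = c"
    using jordan_decomposition[OF \<nu>, of UNIV] zero by (simp_all add: c_def)
  show thesis
  proof (cases "c = 0")
    case True
    \<comment> \<open>Here \<open>\<nu> = 0\<close>, and any two mutually singular probability measures will do: Dirac measures
      at two distinct points.\<close>
    obtain e :: 'a where e: "e \<in> Basis" using nonempty_Basis by blast
    then have "e \<noteq> 0" by (auto simp: nonzero_Basis)
    have "\<nu> A = 0" if "A \<in> sets borel" for A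
    proof -
      have "measure ?p A \<le> c" "measure ?m A \<le> c"
        using that c p.bounded_measure[of A] m.bounded_measure[of A] by (simp_all add: sp sm)
      then show ?thesis using jordan_decomposition[OF \<nu> that] True by (simp add: measure_le_0_iff)
    qed
    moreover have "mutually_singular (return borel 0) (return borel e)"
      unfolding mutually_singular_def using \<open>e \<noteq> 0\<close>
      by (intro conjI bexI[of _ "{0}"]) (auto simp: emeasure_return)
    ultimately have "hahn_jordan_decomposition borel \<nu> 0 (return borel 0) (return borel e)"
      unfolding hahn_jordan_decomposition_def by (auto intro: prob_space_return)
    then show thesis by (rule that)
  next
    case False
    then have c0: "c > 0" by (simp add: c_def less_le)
    let ?n = "scale_measure (ennreal (1 / c))"
    have meas: "measure (?n L) A = measure L A / c" for L :: "'a measure" and A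
      using c0 by (simp add: measure_def enn2real_mult)
    have prob: "prob_space (?n L)" if "finite_measure L" "space L = UNIV" "measure L UNIV = c" for L :: "'a measure"
      using that c0 by (intro prob_spaceI)
        (simp add: space_scale_measure finite_measure.emeasure_eq_measure ennreal_mult' [symmetric])
    obtain S where S: "S \<in> sets ?p" "emeasure ?p (space ?p - S) = 0" "emeasure ?m S = 0"
      using upper_variations_mutually_singular[OF \<nu>] unfolding mutually_singular_def by auto
    have "hahn_jordan_decomposition borel \<nu> c (?n ?p) (?n ?m)"
      unfolding hahn_jordan_decomposition_def
    proof (intro conjI ballI)
      show "mutually_singular (?n ?p) (?n ?m)"
        unfolding mutually_singular_def using S sp sm
        by (intro conjI bexI[of _ S]) (auto simp: space_scale_measure)
      show "\<nu> A = c * (measure (?n ?p) A - measure (?n ?m) A)" if "A \<in> sets borel" for A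
        using jordan_decomposition[OF \<nu> that] c0 by (simp add: meas right_diff_distrib)
    qed (use c0 prob c sp sm p.finite_measure_axioms m.finite_measure_axioms in auto)
    then show thesis by (rule that)
  qed
qed

lemma hahn_jordan_signed_integral:
  assumes hj: "hahn_jordan_decomposition M \<nu> c \<rho>p \<rho>m"
    and f: "f \<in> borel_measurable M" "bounded (range f)"
  shows "signed_integral M \<nu> f = c * ((\<integral>x. f x \<partial>\<rho>p) - (\<integral>x. f x \<partial>\<rho>m))"
proof -
  interpret p: prob_space \<rho>p using hj by (simp add: hahn_jordan_decomposition_def)
  interpret m: prob_space \<rho>m using hj by (simp add: hahn_jordan_decomposition_def)
  have c: "0 \<le> c" and sets: "sets \<rho>p = sets M" "sets \<rho>m = sets M"
    and eq: "\<And>A. A \<in> sets M \<Longrightarrow> \<nu> A = c * (measure \<rho>p A - measure \<rho>m A)"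
    using hj by (auto simp: hahn_jordan_decomposition_def)
  let ?s = "\<lambda>L. density L (\<lambda>_. ennreal c)"
  have fin: "finite_measure (?s L)" and meas: "A \<in> sets L \<Longrightarrow> measure (?s L) A = c * measure L A"
    and int: "f \<in> borel_measurable L \<Longrightarrow> (\<integral>x. f x \<partial>?s L) = c * (\<integral>x. f x \<partial>L)"
    if "prob_space L" for L :: "'a measure" and A
  proof -
    interpret prob_space L by fact
    show "finite_measure (?s L)"
      by (rule finite_measureI) (simp add: emeasure_density_const emeasure_eq_measure ennreal_mult_eq_top_iff)
    show "A \<in> sets L \<Longrightarrow> measure (?s L) A = c * measure L A"
      using c by (simp add: measure_def emeasure_density_const enn2real_mult)
    show "f \<in> borel_measurable L \<Longrightarrow> (\<integral>x. f x \<partial>?s L) = c * (\<integral>x. f x \<partial>L)"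
      using c by (simp add: integral_density)
  qed
  have "signed_integral M \<nu> f = (\<integral>x. f x \<partial>?s \<rho>p) - (\<integral>x. f x \<partial>?s \<rho>m)"
    by (rule signed_integral_difference[OF _ _ _ _ _ f])
      (simp_all add: fin meas sets eq p.prob_space_axioms m.prob_space_axioms right_diff_distrib)
  also have "\<dots> = c * ((\<integral>x. f x \<partial>\<rho>p) - (\<integral>x. f x \<partial>\<rho>m))"
    using f(1) by (simp add: int p.prob_space_axioms m.prob_space_axioms sets right_diff_distrib
        cong: measurable_cong_sets)
  finally show ?thesis .
qed

section \<open>Finite measures are determined by their cosine integrals\<close>

lemma finite_measure_integrable_bounded:
  fixes f :: "'a \<Rightarrow> real"
  assumes "finite_measure M" "f \<in> borel_measurable M" "bounded (range f)"
  shows "integrable M f"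
proof -
  obtain K where "\<And>x. \<bar>f x\<bar> \<le> K" using assms(3) by (auto simp: bounded_iff)
  then show ?thesis
    by (intro finite_measure.integrable_const_bound[OF assms(1), where B=K] assms) auto
qed

text \<open>Levy's uniqueness theorem for the image under \<open>g\<close> of the measures with density \<open>w\<close>, normalized to
  probability measures.\<close>

lemma integral_weighted_indicator_eqI:
  fixes M N :: "'a::topological_space measure" and w g :: "'a \<Rightarrow> real"
  assumes fin: "finite_measure M" "finite_measure N" and sets: "sets M = sets borel" "sets N = sets borel"
    and w: "w \<in> borel_measurable borel" "\<And>x. 0 \<le> w x" "bounded (range w)"
    and g: "g \<in> borel_measurable borel"
    and cos: "\<And>t. (\<integral>x. w x * cos (t * g x) \<partial>M) = (\<integral>x. w x * cos (t * g x) \<partial>N)"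
    and sin: "\<And>t. (\<integral>x. w x * sin (t * g x) \<partial>M) = (\<integral>x. w x * sin (t * g x) \<partial>N)"
    and A: "A \<in> sets borel"
  shows "(\<integral>x. w x * indicator A (g x) \<partial>M) = (\<integral>x. w x * indicator A (g x) \<partial>N)"
proof -
  note [measurable] = w(1) g A
  define c where "c = (\<integral>x. w x \<partial>M)"
  have cN: "(\<integral>x. w x \<partial>N) = c" using cos[of 0] by (simp add: c_def)
  have bnd: "bounded (range (\<lambda>x. w x * h x))" if "\<And>x. \<bar>h x\<bar> \<le> 1" for h
  proof -
    obtain K where K: "\<And>x. \<bar>w x\<bar> \<le> K" using w(3) by (auto simp: bounded_iff)
    have "\<bar>w x * h x\<bar> \<le> K * 1" for x
      unfolding abs_mult using K[of x] that[of x] by (intro mult_mono) auto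
    then show ?thesis by (auto simp: bounded_iff)
  qed
  have int: "integrable L (\<lambda>x. w x * h x)"
    if "finite_measure L" "sets L = sets borel" "h \<in> borel_measurable borel" "\<And>x. \<bar>h x\<bar> \<le> 1" for L h
    using that by (intro finite_measure_integrable_bounded bnd) (auto cong: measurable_cong_sets)
  show ?thesis
  proof (cases "c = 0")
    case True
    have "(\<integral>x. w x * indicator A (g x) \<partial>L) = 0"
      if "finite_measure L" "sets L = sets borel" "(\<integral>x. w x \<partial>L) = c" for L
    proof -
      have "(\<integral>x. w x * indicator A (g x) \<partial>L) \<le> (\<integral>x. w x \<partial>L)"
        using int[OF that(1,2), of "\<lambda>x. 1"] int[OF that(1,2), of "\<lambda>x. indicator A (g x)"] w(2)
        by (intro integral_mono) (auto simp: indicator_def)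
      moreover have "0 \<le> (\<integral>x. w x * indicator A (g x) \<partial>L)"
        using w(2) by (intro integral_nonneg_AE) auto
      ultimately show ?thesis using that(3) True by simp
    qed
    then show ?thesis using fin sets cN c_def by simp
  next
    case False
    moreover have "c \<ge> 0" unfolding c_def using w(2) by (intro integral_nonneg_AE) auto
    ultimately have c: "c > 0" by simp
    define D where "D L = distr (density L (\<lambda>x. ennreal (w x / c))) borel g" for L
    have D: "real_distribution (D L)"
        "char (D L) t = Complex ((\<integral>x. w x * cos (t * g x) \<partial>L) / c) ((\<integral>x. w x * sin (t * g x) \<partial>L) / c)"
        "measure (D L) A = (\<integral>x. w x * indicator A (g x) \<partial>L) / c"
      if L: "finite_measure L" "sets L = sets borel" "(\<integral>x. w x \<partial>L) = c" for L t
    proof -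
      note [measurable_cong] = L(2)
      have "integrable L w" using int[OF L(1,2), of "\<lambda>x. 1"] by simp
      then have "(\<integral>\<^sup>+x. ennreal (w x / c) \<partial>L) = 1"
        using c w(2) L(3) by (subst nn_integral_eq_integral) auto
      then have pr: "prob_space (density L (\<lambda>x. ennreal (w x / c)))"
        by (intro prob_spaceI) (simp add: emeasure_density sets_eq_imp_space_eq[OF L(2)])
      interpret d: prob_space "density L (\<lambda>x. ennreal (w x / c))" by (rule pr)
      show rd: "real_distribution (D L)"
        unfolding D_def by (intro d.real_distribution_distr) simp
      have i: "integrable L (\<lambda>x. w x * cos (t * g x))" "integrable L (\<lambda>x. w x * sin (t * g x))"
        by (intro int[OF L(1,2)]; simp)+
      have "char (D L) t = (\<integral>x. (w x / c) *\<^sub>R iexp (t * g x) \<partial>L)"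
        unfolding char_def D_def using w(2) c by (simp add: integral_distr integral_density)
      also have "\<dots> = (\<integral>x. Complex (w x * cos (t * g x) / c) (w x * sin (t * g x) / c) \<partial>L)"
        by (intro Bochner_Integration.integral_cong) (auto simp: complex_eq_iff exp_eq_polar Re_exp Im_exp)
      also have "\<dots> = (\<integral>x. complex_of_real (w x * cos (t * g x) / c) + \<i> * complex_of_real (w x * sin (t * g x) / c) \<partial>L)"
        by (intro Bochner_Integration.integral_cong) (auto simp: complex_eq_iff)
      also have "\<dots> = complex_of_real (\<integral>x. w x * cos (t * g x) / c \<partial>L) + \<i> * complex_of_real (\<integral>x. w x * sin (t * g x) / c \<partial>L)"
        using i by (subst Bochner_Integration.integral_add) (auto simp del: of_real_divide of_real_mult)
      finally show "char (D L) t = Complex ((\<integral>x. w x * cos (t * g x) \<partial>L) / c) ((\<integral>x. w x * sin (t * g x) \<partial>L) / c)"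
        by (simp add: complex_eq_iff)
      interpret D: real_distribution "D L" by (rule rd)
      have "measure (D L) A = (\<integral>x. indicator A x \<partial>D L)"
        by simp
      also have "\<dots> = (\<integral>x. (w x / c) * indicator A (g x) \<partial>L)"
        unfolding D_def using w(2) c by (subst integral_distr) (simp_all add: integral_density)
      finally show "measure (D L) A = (\<integral>x. w x * indicator A (g x) \<partial>L) / c" by simp
    qed
    have "D M = D N"
      by (intro Levy_uniqueness D(1) fin sets cN ext) (simp_all add: c_def[symmetric] D(2) fin sets cN cos sin)
    then have "measure (D M) A = measure (D N) A" by simp
    then show ?thesis using c by (simp add: D(3) fin sets cN c_def[symmetric])
  qed
qed

text \<open>Reduction to the one-dimensional uniqueness theorem, one coordinate at a time: if the integrals of
  \<open>h(x) cos (u \<bullet> x + \<alpha>)\<close> agree for all \<open>u\<close> and \<open>\<alpha>\<close>, then they still agree after \<open>h\<close> is multiplied by the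
  indicator of a Borel condition on one coordinate. Iterating from \<open>h = 1\<close> yields the indicators of
  boxes, which generate the Borel sets.\<close>

lemma finite_measure_eqI_cos:
  fixes M N :: "'a::euclidean_space measure"
  assumes fin: "finite_measure M" "finite_measure N" and sets: "sets M = sets borel" "sets N = sets borel"
    and cos: "\<And>u \<alpha>. (\<integral>x. cos (u \<bullet> x + \<alpha>) \<partial>M) = (\<integral>x. cos (u \<bullet> x + \<alpha>) \<partial>N)"
  shows "M = N"
proof -
  note [measurable_cong] = sets
  define H where "H h \<longleftrightarrow> h \<in> borel_measurable borel \<and> (\<forall>x. 0 \<le> h x \<and> h x \<le> 1) \<and>
    (\<forall>u \<alpha>. (\<integral>x. h x * cos (u \<bullet> x + \<alpha>) \<partial>M) = (\<integral>x. h x * cos (u \<bullet> x + \<alpha>) \<partial>N))" for h :: "'a \<Rightarrow> real"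
  have step: "H (\<lambda>x. h x * indicator A (x \<bullet> e))" if h: "H h" and A[measurable]: "A \<in> sets borel" for h A e
  proof -
    have [measurable]: "h \<in> borel_measurable borel" and h01: "\<And>x. 0 \<le> h x" "\<And>x. h x \<le> 1"
      and hc: "\<And>u \<alpha>. (\<integral>x. h x * cos (u \<bullet> x + \<alpha>) \<partial>M) = (\<integral>x. h x * cos (u \<bullet> x + \<alpha>) \<partial>N)"
      using h by (auto simp: H_def)
    have hb: "\<bar>h x * y\<bar> \<le> 1" if "\<bar>y\<bar> \<le> 1" for x y
      unfolding abs_mult using h01[of x] that by (intro mult_le_one) auto
    have int: "integrable L (\<lambda>x. h x * f x)"
      if "finite_measure L" "sets L = sets borel" "f \<in> borel_measurable borel" "\<And>x. \<bar>f x\<bar> \<le> 1" for f L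
      using that hb by (intro finite_measure_integrable_bounded) (auto simp: bounded_iff intro!: exI[of _ 1] cong: measurable_cong_sets)
    \<comment> \<open>The one-dimensional theorem needs nonnegative weights: use \<open>h (1 + cos)\<close> and \<open>h\<close>, the cases
      \<open>k = 1\<close> and \<open>k = 0\<close>, and subtract afterwards. The product of two cosines is a sum of cosines, so
      the hypothesis on \<open>h\<close> covers the characteristic functions of these weights.\<close>
    have w: "(\<integral>x. h x * (1 + k * cos (u \<bullet> x + \<alpha>)) * indicator A (x \<bullet> e) \<partial>M) =
        (\<integral>x. h x * (1 + k * cos (u \<bullet> x + \<alpha>)) * indicator A (x \<bullet> e) \<partial>N)"
      if k: "0 \<le> k" "k \<le> 1" for k u \<alpha>
    proof -
      have trig: "(\<integral>x. h x * (1 + k * cos (u \<bullet> x + \<alpha>)) * cos (t * (x \<bullet> e) + \<beta>) \<partial>L) =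
          (\<integral>x. h x * cos ((t *\<^sub>R e) \<bullet> x + \<beta>) \<partial>L)
          + k / 2 * (\<integral>x. h x * cos ((u + t *\<^sub>R e) \<bullet> x + (\<alpha> + \<beta>)) \<partial>L)
          + k / 2 * (\<integral>x. h x * cos ((u - t *\<^sub>R e) \<bullet> x + (\<alpha> - \<beta>)) \<partial>L)"
        if "finite_measure L" "sets L = sets borel" for t \<beta> L
      proof -
        have "h x * (1 + k * cos (u \<bullet> x + \<alpha>)) * cos (t * (x \<bullet> e) + \<beta>) =
           h x * cos ((t *\<^sub>R e) \<bullet> x + \<beta>) + k / 2 * (h x * cos ((u + t *\<^sub>R e) \<bullet> x + (\<alpha> + \<beta>)))
           + k / 2 * (h x * cos ((u - t *\<^sub>R e) \<bullet> x + (\<alpha> - \<beta>)))" for x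
        proof -
          define a b where "a = u \<bullet> x + \<alpha>" and "b = t * (x \<bullet> e) + \<beta>"
          have E: "(u + t *\<^sub>R e) \<bullet> x + (\<alpha> + \<beta>) = a + b" "(u - t *\<^sub>R e) \<bullet> x + (\<alpha> - \<beta>) = a - b"
            "(t *\<^sub>R e) \<bullet> x + \<beta> = b"
            by (simp_all add: a_def b_def inner_commute algebra_simps)
          show ?thesis
            unfolding E a_def[symmetric] b_def[symmetric] unfolding cos_add cos_diff
            by (simp add: algebra_simps)
        qed
        moreover have "integrable L (\<lambda>x. h x * cos (v \<bullet> x + \<gamma>))" for v \<gamma>
          by (intro int that) auto
        ultimately show ?thesis by (simp del: inner_scaleR_left)
      qed
      have trig': "(\<integral>x. h x * (1 + k * cos (u \<bullet> x + \<alpha>)) * cos (t * (x \<bullet> e) + \<beta>) \<partial>M) =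
          (\<integral>x. h x * (1 + k * cos (u \<bullet> x + \<alpha>)) * cos (t * (x \<bullet> e) + \<beta>) \<partial>N)" for t \<beta>
        by (simp only: trig fin sets hc)
      have kc: "\<bar>k * cos y\<bar> \<le> 1" for y
        unfolding abs_mult using k by (intro mult_le_one) auto
      show ?thesis
      proof (rule integral_weighted_indicator_eqI[OF fin sets])
        show "0 \<le> h x * (1 + k * cos (u \<bullet> x + \<alpha>))" for x
          using h01(1)[of x] kc[of "u \<bullet> x + \<alpha>"] by (intro mult_nonneg_nonneg) (auto simp: abs_le_iff)
        have "\<bar>h x * (1 + k * cos (u \<bullet> x + \<alpha>))\<bar> \<le> 1 * 2" for x
          unfolding abs_mult using h01[of x] kc[of "u \<bullet> x + \<alpha>"] by (intro mult_mono) (auto simp: abs_le_iff)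
        then show "bounded (range (\<lambda>x. h x * (1 + k * cos (u \<bullet> x + \<alpha>))))"
          by (auto simp: bounded_iff)
        show "(\<integral>x. h x * (1 + k * cos (u \<bullet> x + \<alpha>)) * cos (t * (x \<bullet> e)) \<partial>M) =
          (\<integral>x. h x * (1 + k * cos (u \<bullet> x + \<alpha>)) * cos (t * (x \<bullet> e)) \<partial>N)" for t
          using trig'[of t 0] by simp
        have "cos (y - pi / 2) = sin y" for y :: real by (simp add: cos_diff)
        then show "(\<integral>x. h x * (1 + k * cos (u \<bullet> x + \<alpha>)) * sin (t * (x \<bullet> e)) \<partial>M) =
          (\<integral>x. h x * (1 + k * cos (u \<bullet> x + \<alpha>)) * sin (t * (x \<bullet> e)) \<partial>N)" for t
          using trig'[of t "- (pi / 2)"] by simp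
      qed auto
    qed
    have "(\<integral>x. h x * indicator A (x \<bullet> e) * cos (u \<bullet> x + \<alpha>) \<partial>M) =
        (\<integral>x. h x * indicator A (x \<bullet> e) * cos (u \<bullet> x + \<alpha>) \<partial>N)" for u \<alpha>
    proof -
      have d: "(\<integral>x. h x * indicator A (x \<bullet> e) * cos (u \<bullet> x + \<alpha>) \<partial>L) =
        (\<integral>x. h x * (1 + 1 * cos (u \<bullet> x + \<alpha>)) * indicator A (x \<bullet> e) \<partial>L) -
        (\<integral>x. h x * (1 + 0 * cos (u \<bullet> x + \<alpha>)) * indicator A (x \<bullet> e) \<partial>L)"
        if "finite_measure L" "sets L = sets borel" for L
      proof -
        have "integrable L (\<lambda>x. h x * (cos (u \<bullet> x + \<alpha>) * indicator A (x \<bullet> e)))"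
          "integrable L (\<lambda>x. h x * indicator A (x \<bullet> e))"
          by (intro int that; auto simp: indicator_def)+
        then show ?thesis by (simp add: algebra_simps)
      qed
      show ?thesis using w[of 0 u \<alpha>] w[of 1 u \<alpha>] by (simp only: d[OF fin(1) sets(1)] d[OF fin(2) sets(2)])
    qed
    then show ?thesis
      using h01 by (auto simp: H_def indicator_def)
  qed
  have H1: "H (\<lambda>x. 1)" using cos by (simp add: H_def)
  have boxes: "H (\<lambda>x. \<Prod>e\<in>F. indicator {a \<bullet> e<..<b \<bullet> e} (x \<bullet> e))" if "finite F" for F a b
    using that
  proof induction
    case empty then show ?case using H1 by simp
  next
    case (insert e F)
    then show ?case using step[OF insert.IH, of "{a \<bullet> e<..<b \<bullet> e}" e] by (simp add: mult.commute)
  qed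
  have box: "emeasure M (box a b) = emeasure N (box a b)" for a b
  proof -
    have "(\<Prod>e\<in>Basis. indicator {a \<bullet> e<..<b \<bullet> e} (x \<bullet> e)) = (indicator (box a b) x :: real)" for x
      by (auto simp: indicator_def box_def prod_zero_iff)
    moreover have "(\<integral>x. (\<Prod>e\<in>Basis. indicator {a \<bullet> e<..<b \<bullet> e} (x \<bullet> e)) * cos (0 \<bullet> x + 0) \<partial>M) =
      (\<integral>x. (\<Prod>e\<in>Basis. indicator {a \<bullet> e<..<b \<bullet> e} (x \<bullet> e)) * cos (0 \<bullet> x + 0) \<partial>N)"
      using boxes[OF finite_Basis, of a b] unfolding H_def by blast
    ultimately have "measure M (box a b) = measure N (box a b)"
      using sets_eq_imp_space_eq[OF sets(1)] sets_eq_imp_space_eq[OF sets(2)] by simp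
    then show ?thesis using fin by (simp add: finite_measure.emeasure_eq_measure)
  qed
  have sb: "sets borel = sigma_sets UNIV (range (\<lambda>(a, b). box a b :: 'a set))"
    by (subst borel_eq_box) simp
  show ?thesis
  proof (rule measure_eqI_generator_eq[where \<Omega>=UNIV and E="range (\<lambda>(a, b). box a b)"
        and A="\<lambda>i::nat. box (- (real i *\<^sub>R One)) (real i *\<^sub>R One)"])
    show "Int_stable (range (\<lambda>(a, b). box a b :: 'a set))"
      by (auto simp: Int_stable_def box_Int_box)
    show "emeasure M (box (- (real i *\<^sub>R One)) (real i *\<^sub>R One)) \<noteq> \<infinity>" for i
      using fin(1) by (simp add: finite_measure.emeasure_eq_measure)
  qed (use box sets sb UN_box_eq_UNIV in auto)
qed

section \<open>The standard Gaussian measure\<close>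

definition std_gaussian :: "'a::euclidean_space measure" where
  "std_gaussian = density lborel (\<lambda>x. ennreal (\<Prod>b\<in>Basis. std_normal_density (x \<bullet> b)))"

lemma sets_std_gaussian [simp, measurable_cong]: "sets std_gaussian = sets borel"
  and space_std_gaussian [simp]: "space std_gaussian = UNIV"
  by (simp_all add: std_gaussian_def)

lemma std_gaussian_real: "std_gaussian = std_normal_distribution"
  by (simp add: std_gaussian_def)

lemma prod_std_normal_density:
  fixes x :: "'a::euclidean_space"
  shows "(\<Prod>b\<in>Basis. std_normal_density (x \<bullet> b)) = (1 / sqrt (2 * pi)) ^ DIM('a) * exp (- (norm x)\<^sup>2 / 2)"
proof -
  have "(\<Prod>b\<in>(Basis::'a set). exp (- (x \<bullet> b)\<^sup>2 / 2)) = exp (\<Sum>b\<in>Basis. - (x \<bullet> b)\<^sup>2 / 2)"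
    by (simp add: exp_sum)
  also have "(\<Sum>b\<in>(Basis::'a set). - (x \<bullet> b)\<^sup>2 / 2) = - (norm x)\<^sup>2 / 2"
    by (subst power2_norm_eq_inner, subst euclidean_inner)
      (simp add: sum_negf sum_divide_distrib power2_eq_square)
  finally show ?thesis by (simp add: std_normal_density_def prod_dividef power_divide)
qed

lemma prob_space_std_gaussian: "prob_space (std_gaussian :: 'a::euclidean_space measure)"
proof
  have "(\<integral>\<^sup>+x. ennreal (\<Prod>b\<in>Basis. std_normal_density (x \<bullet> b)) \<partial>(lborel :: 'a measure)) =
      (\<integral>\<^sup>+x. (\<Prod>b\<in>Basis. ennreal (std_normal_density (x \<bullet> b))) \<partial>(lborel :: 'a measure))"
    by (simp add: prod_ennreal)
  also have "\<dots> = (\<Prod>b\<in>(Basis :: 'a set). \<integral>\<^sup>+x. ennreal (std_normal_density x) \<partial>lborel)"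
    by (rule nn_integral_lborel_prod) auto
  also have "(\<integral>\<^sup>+x. ennreal (std_normal_density x) \<partial>lborel) = 1"
    by (subst nn_integral_eq_integral) auto
  finally show "emeasure (std_gaussian :: 'a measure) (space std_gaussian) = 1"
    by (simp add: std_gaussian_def emeasure_density)
qed

interpretation std_gaussian: prob_space "std_gaussian :: 'a::euclidean_space measure"
  by (rule prob_space_std_gaussian)

lemma std_gaussian_char:
  fixes u :: "'a::euclidean_space"
  shows "(\<integral>x. iexp (u \<bullet> x) \<partial>std_gaussian) = complex_of_real (exp (- (norm u)\<^sup>2 / 2))"
proof -
  interpret product_sigma_finite "\<lambda>_::'a. lborel :: real measure" ..
  define g where "g b y = std_normal_density y *\<^sub>R iexp ((u \<bullet> b) * y)" for b y
  have g: "integrable lborel (g b)" "integral\<^sup>L lborel (g b) = complex_of_real (exp (- (u \<bullet> b)\<^sup>2 / 2))" for b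
  proof -
    interpret N: real_distribution std_normal_distribution by (rule real_dist_normal_dist)
    have i: "integrable std_normal_distribution (\<lambda>y. iexp ((u \<bullet> b) * y))"
      by (rule N.integrable_iexp) auto
    then show "integrable lborel (g b)" unfolding g_def by (subst (asm) integrable_density) auto
    have "integral\<^sup>L lborel (g b) = char std_normal_distribution (u \<bullet> b)"
      unfolding g_def char_def by (subst integral_density) auto
    then show "integral\<^sup>L lborel (g b) = complex_of_real (exp (- (u \<bullet> b)\<^sup>2 / 2))"
      by (simp add: char_std_normal_distribution)
  qed
  have [measurable]: "g b \<in> borel_measurable borel" for b
    unfolding g_def by measurable
  have pr: "(\<Prod>b\<in>Basis. std_normal_density (x \<bullet> b)) *\<^sub>R iexp (u \<bullet> x) = (\<Prod>b\<in>Basis. g b (x \<bullet> b))" for x :: 'a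
  proof -
    have "iexp (u \<bullet> x) = exp (\<Sum>b\<in>Basis. \<i> * complex_of_real ((u \<bullet> b) * (x \<bullet> b)))"
      by (subst euclidean_inner) (simp add: sum_distrib_left)
    also have "\<dots> = (\<Prod>b\<in>Basis. iexp ((u \<bullet> b) * (x \<bullet> b)))"
      by (rule exp_sum) simp
    finally show ?thesis by (simp add: g_def scaleR_conv_of_real prod.distrib)
  qed
  have "(\<integral>x. iexp (u \<bullet> x) \<partial>std_gaussian) =
      (\<integral>x. (\<Prod>b\<in>Basis. std_normal_density (x \<bullet> b)) *\<^sub>R iexp (u \<bullet> x) \<partial>lborel)"
    unfolding std_gaussian_def by (rule integral_density) (auto intro!: prod_nonneg)
  also have "\<dots> = (\<integral>x. (\<Prod>b\<in>Basis. g b (x \<bullet> b)) \<partial>lborel)"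
    by (simp only: pr)
  also have "\<dots> = (\<integral>f. (\<Prod>b\<in>Basis. g b (f b)) \<partial>(\<Pi>\<^sub>M b\<in>(Basis::'a set). lborel))"
    by (subst lborel_eq, subst integral_distr) auto
  also have "\<dots> = (\<Prod>b\<in>Basis. integral\<^sup>L lborel (g b))"
    by (rule product_integral_prod) (auto intro: g)
  also have "\<dots> = (\<Prod>b\<in>(Basis::'a set). complex_of_real (exp (- (u \<bullet> b)\<^sup>2 / 2)))"
    by (simp only: g)
  also have "\<dots> = complex_of_real (exp (\<Sum>b\<in>(Basis::'a set). - (u \<bullet> b)\<^sup>2 / 2))"
    by (simp add: exp_sum del: of_real_exp)
  also have "(\<Sum>b\<in>(Basis::'a set). - (u \<bullet> b)\<^sup>2 / 2) = - (norm u)\<^sup>2 / 2"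
    by (subst power2_norm_eq_inner, subst euclidean_inner)
      (simp add: sum_negf sum_divide_distrib power2_eq_square)
  finally show ?thesis .
qed

lemma std_gaussian_cos:
  fixes u :: "'a::euclidean_space"
  shows "(\<integral>x. cos (u \<bullet> x + \<alpha>) \<partial>std_gaussian) = cos \<alpha> * exp (- (norm u)\<^sup>2 / 2)"
proof -
  have i: "integrable std_gaussian (\<lambda>x. iexp (u \<bullet> x))"
    by (rule std_gaussian.integrable_iexp) auto
  have "(\<integral>x. cos (u \<bullet> x + \<alpha>) \<partial>std_gaussian) = (\<integral>x. Re (iexp \<alpha> * iexp (u \<bullet> x)) \<partial>std_gaussian)"
    by (intro Bochner_Integration.integral_cong) (simp_all add: Re_exp Im_exp cos_add)
  also have "\<dots> = Re (iexp \<alpha> * (\<integral>x. iexp (u \<bullet> x) \<partial>std_gaussian))"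
    using i by (subst integral_Re) auto
  also have "\<dots> = cos \<alpha> * exp (- (norm u)\<^sup>2 / 2)"
    by (simp only: std_gaussian_char) (simp add: Re_exp del: of_real_exp)
  finally show ?thesis .
qed

lemma normal_law_cos:
  assumes "0 \<le> v"
  shows "(\<integral>x. cos (x + \<alpha>) \<partial>normal_law m v) = cos (m + \<alpha>) * exp (- v / 2)"
proof (cases "v = 0")
  case True
  then show ?thesis by (simp add: normal_law_def integral_return)
next
  case False
  define s where "s = sqrt v"
  have s: "s > 0" "s\<^sup>2 = v" using False assms by (auto simp: s_def)
  have d: "s * normal_density m s (m + s * x) = std_normal_density x" for x
    using s(1) by (simp add: normal_density_def real_sqrt_mult power_mult_distrib)
  have "(\<integral>x. cos (x + \<alpha>) \<partial>normal_law m v) = (\<integral>x. normal_density m s x * cos (x + \<alpha>) \<partial>lborel)"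
    using False s(1) by (simp add: normal_law_def s_def integral_density)
  also have "\<dots> = (\<integral>x. s * normal_density m s (m + s * x) * cos (m + s * x + \<alpha>) \<partial>lborel)"
    using s(1) by (subst lborel_integral_real_affine[of s _ m]) (auto simp: mult.assoc)
  also have "\<dots> = (\<integral>x. std_normal_density x * cos (s * x + (m + \<alpha>)) \<partial>lborel)"
    by (simp only: d) (simp add: ac_simps)
  also have "\<dots> = (\<integral>x. cos (s \<bullet> x + (m + \<alpha>)) \<partial>std_gaussian)"
    unfolding std_gaussian_real by (subst integral_density) auto
  also have "\<dots> = cos (m + \<alpha>) * exp (- v / 2)"
    by (subst std_gaussian_cos) (simp add: s)
  finally show ?thesis .
qed

lemma gaussian_law_cos:
  assumes P: "gaussian_law \<mu> A P" and "0 \<le> u \<bullet> (A *v u)"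
  shows "(\<integral>x. cos (u \<bullet> x + \<alpha>) \<partial>P) = cos (u \<bullet> \<mu> + \<alpha>) * exp (- (u \<bullet> (A *v u)) / 2)"
proof -
  have [measurable_cong]: "sets P = sets borel" using P by (simp add: gaussian_law_def)
  have "(\<integral>x. cos (u \<bullet> x + \<alpha>) \<partial>P) = (\<integral>y. cos (y + \<alpha>) \<partial>distr P borel (\<lambda>x. u \<bullet> x))"
    by (subst integral_distr) auto
  also have "\<dots> = cos (u \<bullet> \<mu> + \<alpha>) * exp (- (u \<bullet> (A *v u)) / 2)"
    using P normal_law_cos[OF assms(2)] by (simp add: gaussian_law_def)
  finally show ?thesis .
qed

lemma borel_measurable_matrix_vector_mult [measurable]:
  fixes B :: "real^'d^'n"
  shows "(\<lambda>z. B *v z) \<in> borel_measurable borel"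
  by (intro borel_measurable_continuous_onI matrix_vector_mult_linear_continuous_on)

lemma affine_std_gaussian_cos:
  fixes B :: "real^'d^'n"
  shows "(\<integral>x. cos (u \<bullet> x + \<alpha>) \<partial>distr std_gaussian borel (\<lambda>z. \<mu> + B *v z)) =
    cos (u \<bullet> \<mu> + \<alpha>) * exp (- (norm (transpose B *v u))\<^sup>2 / 2)"
proof -
  have "(\<integral>x. cos (u \<bullet> x + \<alpha>) \<partial>distr std_gaussian borel (\<lambda>z. \<mu> + B *v z)) =
      (\<integral>z. cos ((transpose B *v u) \<bullet> z + (u \<bullet> \<mu> + \<alpha>)) \<partial>std_gaussian)"
    by (subst integral_distr) (auto simp: inner_add_right dot_lmul_matrix[symmetric] ac_simps)
  then show ?thesis by (simp add: std_gaussian_cos)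
qed

text \<open>Both measures have the same cosine integrals, since \<open>u \<bullet> B B\<^sup>T u = |B\<^sup>T u|\<^sup>2\<close>.\<close>

lemma gaussian_law_eq_distr:
  fixes B :: "real^'d^'n"
  assumes P: "gaussian_law \<mu> (B ** transpose B) P"
  shows "P = distr std_gaussian borel (\<lambda>z. \<mu> + B *v z)"
proof (rule finite_measure_eqI_cos)
  have quad: "u \<bullet> ((B ** transpose B) *v u) = (norm (transpose B *v u))\<^sup>2" for u
    by (simp add: power2_norm_eq_inner matrix_vector_mul_assoc[symmetric] dot_lmul_matrix[symmetric])
  show "finite_measure P" using P by (simp add: gaussian_law_def prob_space.finite_measure)
  show "sets P = sets borel" using P by (simp add: gaussian_law_def)
  show "finite_measure (distr std_gaussian borel (\<lambda>z. \<mu> + B *v z))"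
    by (intro prob_space.finite_measure std_gaussian.prob_space_distr) simp
  show "(\<integral>x. cos (u \<bullet> x + \<alpha>) \<partial>P) = (\<integral>x. cos (u \<bullet> x + \<alpha>) \<partial>distr std_gaussian borel (\<lambda>z. \<mu> + B *v z))" for u \<alpha>
    by (simp add: affine_std_gaussian_cos gaussian_law_cos[OF P] quad)
qed simp

section \<open>Differentiability of Gaussian integrals under translation\<close>

definition shift_density :: "'a::euclidean_space \<Rightarrow> 'a \<Rightarrow> real" where
  "shift_density v x = exp (v \<bullet> x - (norm v)\<^sup>2 / 2)"

lemma shift_density_measurable [measurable]: "shift_density v \<in> borel_measurable borel"
  unfolding shift_density_def by measurable

text \<open>Complete the square: \<open>-|x|\<^sup>2/2 + v \<bullet> x - |v|\<^sup>2/2 = -|x - v|\<^sup>2/2\<close>.\<close>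

lemma cameron_martin:
  fixes v :: "'a::euclidean_space"
  shows "distr std_gaussian borel (\<lambda>x. x + v) = density std_gaussian (\<lambda>x. ennreal (shift_density v x))"
proof (rule measure_eqI)
  fix A :: "'a set" assume "A \<in> sets (distr std_gaussian borel (\<lambda>x. x + v))"
  then have [measurable]: "A \<in> sets borel" by simp
  have [measurable]: "(\<lambda>x. x + v) -` A \<in> sets borel"
    using measurable_sets[of "\<lambda>x. x + v" borel borel A] by simp
  define \<phi> where "\<phi> x = (\<Prod>b\<in>Basis. std_normal_density (x \<bullet> b))" for x :: 'a
  have [measurable]: "\<phi> \<in> borel_measurable borel" unfolding \<phi>_def by measurable
  have \<phi>0: "0 \<le> \<phi> x" for x unfolding \<phi>_def by (intro prod_nonneg) simp
  have shift: "\<phi> x * shift_density v x = \<phi> (x - v)" for x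
  proof -
    have "- (norm x)\<^sup>2 / 2 + (v \<bullet> x - (norm v)\<^sup>2 / 2) = - (norm (x - v))\<^sup>2 / 2"
      unfolding power2_norm_eq_inner by (simp add: inner_diff inner_commute field_simps)
    then show ?thesis
      unfolding \<phi>_def prod_std_normal_density shift_density_def mult.assoc mult_exp_exp by simp
  qed
  have "emeasure (distr std_gaussian borel (\<lambda>x. x + v)) A = (\<integral>\<^sup>+x. ennreal (\<phi> x) * indicator A (x + v) \<partial>lborel)"
    by (simp add: emeasure_distr emeasure_density std_gaussian_def \<phi>_def[symmetric] indicator_def
        cong: if_cong)
  also have "\<dots> = (\<integral>\<^sup>+y. ennreal (\<phi> (y - v)) * indicator A y \<partial>distr lborel borel ((+) v))"
    by (subst nn_integral_distr) (auto simp: add.commute)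
  also have "\<dots> = (\<integral>\<^sup>+y. ennreal (\<phi> y) * (ennreal (shift_density v y) * indicator A y) \<partial>lborel)"
    unfolding lborel_distr_plus using \<phi>0
    by (intro nn_integral_cong) (simp add: shift[symmetric] ennreal_mult' mult.assoc)
  also have "\<dots> = emeasure (density std_gaussian (\<lambda>x. ennreal (shift_density v x))) A"
    by (simp add: std_gaussian_def \<phi>_def[symmetric] emeasure_density nn_integral_density)
  finally show "emeasure (distr std_gaussian borel (\<lambda>x. x + v)) A =
      emeasure (density std_gaussian (\<lambda>x. ennreal (shift_density v x))) A" .
qed simp

lemma
  fixes g :: "'a::euclidean_space \<Rightarrow> real"
  assumes [measurable]: "g \<in> borel_measurable borel"
  shows integrable_mult_shift_density:
      "integrable std_gaussian (\<lambda>x. g x * shift_density v x) \<longleftrightarrow> integrable std_gaussian (\<lambda>x. g (x + v))"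
    and integral_mult_shift_density:
      "(\<integral>x. g x * shift_density v x \<partial>std_gaussian) = (\<integral>x. g (x + v) \<partial>std_gaussian)"
proof -
  have nn: "0 \<le> shift_density v x" for x by (simp add: shift_density_def)
  have "integrable std_gaussian (\<lambda>x. g x * shift_density v x) \<longleftrightarrow>
      integrable (density std_gaussian (\<lambda>x. ennreal (shift_density v x))) g"
    using nn by (subst integrable_density) (auto simp: mult.commute)
  also have "\<dots> \<longleftrightarrow> integrable std_gaussian (\<lambda>x. g (x + v))"
    unfolding cameron_martin[symmetric] by (subst integrable_distr_eq) auto
  finally show "integrable std_gaussian (\<lambda>x. g x * shift_density v x) \<longleftrightarrow> integrable std_gaussian (\<lambda>x. g (x + v))" .
  have "(\<integral>x. g x * shift_density v x \<partial>std_gaussian) =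
      (\<integral>x. g x \<partial>density std_gaussian (\<lambda>x. ennreal (shift_density v x)))"
    using nn by (subst integral_density) (auto simp: mult.commute)
  also have "\<dots> = (\<integral>x. g (x + v) \<partial>std_gaussian)"
    unfolding cameron_martin[symmetric] by (subst integral_distr) auto
  finally show "(\<integral>x. g x * shift_density v x \<partial>std_gaussian) = (\<integral>x. g (x + v) \<partial>std_gaussian)" .
qed

lemma distr_std_gaussian_inner:
  fixes v :: "'a::euclidean_space"
  shows "distr std_gaussian borel (\<lambda>x. v \<bullet> x) = distr std_gaussian borel (\<lambda>z::real. norm v * z)"
proof (rule finite_measure_eqI_cos)
  fix u \<alpha> :: real
  have "(\<integral>x. cos (u \<bullet> x + \<alpha>) \<partial>distr std_gaussian borel (\<lambda>x. v \<bullet> x)) =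
      (\<integral>x. cos ((u *\<^sub>R v) \<bullet> x + \<alpha>) \<partial>std_gaussian)"
    by (subst integral_distr) auto
  also have "\<dots> = (\<integral>z. cos ((u * norm v) \<bullet> z + \<alpha>) \<partial>std_gaussian)"
    by (simp only: std_gaussian_cos norm_scaleR real_norm_def abs_mult abs_norm_cancel)
  also have "\<dots> = (\<integral>x. cos (u \<bullet> x + \<alpha>) \<partial>distr std_gaussian borel (\<lambda>z::real. norm v * z))"
    by (subst integral_distr) (auto simp: mult.assoc)
  finally show "(\<integral>x. cos (u \<bullet> x + \<alpha>) \<partial>distr std_gaussian borel (\<lambda>x. v \<bullet> x)) =
     (\<integral>x. cos (u \<bullet> x + \<alpha>) \<partial>distr std_gaussian borel (\<lambda>z::real. norm v * z))" .
qed (auto intro!: prob_space.finite_measure std_gaussian.prob_space_distr)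

lemma
  fixes v :: "'a::euclidean_space"
  shows std_gaussian_integrable_inner: "integrable std_gaussian (\<lambda>x. v \<bullet> x)"
    and std_gaussian_integral_inner: "(\<integral>x. v \<bullet> x \<partial>std_gaussian) = 0"
    and std_gaussian_integrable_inner2: "integrable std_gaussian (\<lambda>x. (v \<bullet> x)\<^sup>2)"
    and std_gaussian_integral_inner2: "(\<integral>x. (v \<bullet> x)\<^sup>2 \<partial>std_gaussian) = (norm v)\<^sup>2"
proof -
  have i: "integrable std_gaussian (\<lambda>x. (v \<bullet> x) ^ k)"
    and e: "(\<integral>x. (v \<bullet> x) ^ k \<partial>std_gaussian) = norm v ^ k * (\<integral>z. z ^ k \<partial>std_normal_distribution)" for k
  proof -
    have "integrable (distr std_gaussian borel (\<lambda>x. v \<bullet> x)) (\<lambda>y. y ^ k)"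
      unfolding distr_std_gaussian_inner
      by (subst integrable_distr_eq)
        (auto simp: power_mult_distrib std_gaussian_real intro!: integrable_std_normal_distribution_moment)
    then show "integrable std_gaussian (\<lambda>x. (v \<bullet> x) ^ k)"
      by (subst (asm) integrable_distr_eq) auto
    have "(\<integral>x. (v \<bullet> x) ^ k \<partial>std_gaussian) = (\<integral>y. y ^ k \<partial>distr std_gaussian borel (\<lambda>x. v \<bullet> x))"
      by (subst integral_distr) auto
    also have "\<dots> = norm v ^ k * (\<integral>z. z ^ k \<partial>std_normal_distribution)"
      unfolding distr_std_gaussian_inner
      by (subst integral_distr) (auto simp: power_mult_distrib std_gaussian_real)
    finally show "(\<integral>x. (v \<bullet> x) ^ k \<partial>std_gaussian) = norm v ^ k * (\<integral>z. z ^ k \<partial>std_normal_distribution)" .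
  qed
  show "integrable std_gaussian (\<lambda>x. v \<bullet> x)" using i[of 1] by simp
  show "integrable std_gaussian (\<lambda>x. (v \<bullet> x)\<^sup>2)" using i[of 2] by simp
  show "(\<integral>x. v \<bullet> x \<partial>std_gaussian) = 0"
    using e[of 1] integral_std_normal_distribution_moment_odd[of 1] by simp
  show "(\<integral>x. (v \<bullet> x)\<^sup>2 \<partial>std_gaussian) = (norm v)\<^sup>2"
    using e[of 2] std_normal_distribution_even_moments(1)[of 1] by simp
qed

text \<open>By Jensen the \<open>L\<^sup>1\<close> norm is at most the \<open>L\<^sup>2\<close> norm, and the square of the latter is exactly
  \<open>exp (|v|\<^sup>2) - 1 - |v|\<^sup>2\<close>: the square of the density for \<open>v\<close> is a multiple of the density for \<open>2v\<close>,
  and its product with \<open>v \<bullet> x\<close> integrates to \<open>|v|\<^sup>2\<close> by the Cameron--Martin formula.\<close>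

lemma shift_density_remainder:
  fixes v :: "'a::euclidean_space"
  defines "R \<equiv> \<lambda>x. shift_density v x - 1 - v \<bullet> x"
  shows "integrable std_gaussian R"
    and "(\<integral>x. \<bar>R x\<bar> \<partial>std_gaussian) \<le> sqrt (exp ((norm v)\<^sup>2) - 1 - (norm v)\<^sup>2)"
proof -
  let ?E = "shift_density v" and ?G = "std_gaussian :: 'a measure"
  have E: "integrable ?G ?E" "(\<integral>x. ?E x \<partial>?G) = 1"
    using integrable_mult_shift_density[of "\<lambda>_. 1" v] integral_mult_shift_density[of "\<lambda>_. 1" v]
    by (simp_all add: std_gaussian.prob_space[simplified])
  have sq: "(?E x)\<^sup>2 = exp ((norm v)\<^sup>2) * shift_density (2 *\<^sub>R v) x" for x
    by (simp add: shift_density_def power2_eq_square algebra_simps flip: exp_add)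
  have E2: "integrable ?G (\<lambda>x. (?E x)\<^sup>2)" "(\<integral>x. (?E x)\<^sup>2 \<partial>?G) = exp ((norm v)\<^sup>2)"
    using integrable_mult_shift_density[of "\<lambda>_. 1" "2 *\<^sub>R v"]
      integral_mult_shift_density[of "\<lambda>_. 1" "2 *\<^sub>R v"]
    by (simp_all add: sq std_gaussian.prob_space[simplified])
  have iE: "integrable ?G (\<lambda>x. (v \<bullet> x) * ?E x)" "(\<integral>x. (v \<bullet> x) * ?E x \<partial>?G) = (norm v)\<^sup>2"
    using integrable_mult_shift_density[of "\<lambda>x. v \<bullet> x" v] integral_mult_shift_density[of "\<lambda>x. v \<bullet> x" v]
      std_gaussian_integrable_inner[of v] std_gaussian_integral_inner[of v]
    by (simp_all add: inner_add_right power2_norm_eq_inner std_gaussian.prob_space[simplified])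
  note I = E(1) E2(1) iE(1) std_gaussian_integrable_inner[of v] std_gaussian_integrable_inner2[of v]
  show R: "integrable ?G R" unfolding R_def using I by simp
  have R2: "(R x)\<^sup>2 = (?E x)\<^sup>2 + 1 + (v \<bullet> x)\<^sup>2 - 2 * ?E x - 2 * ((v \<bullet> x) * ?E x) + 2 * (v \<bullet> x)" for x
    by (simp add: R_def power2_eq_square algebra_simps)
  have "integrable ?G (\<lambda>x. (R x)\<^sup>2)" unfolding R2 using I by simp
  moreover have "(\<integral>x. (R x)\<^sup>2 \<partial>?G) = exp ((norm v)\<^sup>2) - 1 - (norm v)\<^sup>2"
    unfolding R2 using I E(2) E2(2) iE(2) std_gaussian_integral_inner[of v] std_gaussian_integral_inner2[of v]
    by (simp add: std_gaussian.prob_space[simplified])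
  moreover have "0 \<le> std_gaussian.variance (\<lambda>x. \<bar>R x\<bar>)"
    by (rule std_gaussian.variance_positive)
  ultimately have "(\<integral>x. \<bar>R x\<bar> \<partial>?G)\<^sup>2 \<le> exp ((norm v)\<^sup>2) - 1 - (norm v)\<^sup>2"
    using R by (simp add: std_gaussian.variance_eq)
  then show "(\<integral>x. \<bar>R x\<bar> \<partial>?G) \<le> sqrt (exp ((norm v)\<^sup>2) - 1 - (norm v)\<^sup>2)"
    by (rule real_le_rsqrt)
qed

lemma exp_remainder_le:
  assumes "0 \<le> s" "s \<le> 1" shows "sqrt (exp (s\<^sup>2) - 1 - s\<^sup>2) \<le> s\<^sup>2"
proof -
  have "exp (s\<^sup>2) \<le> 1 + s\<^sup>2 + (s\<^sup>2)\<^sup>2"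
    using assms by (intro exp_bound) (auto simp: power_le_one)
  then show ?thesis by (intro real_le_lsqrt) auto
qed

text \<open>Since \<open>F\<close> is only measurable, the translation is moved from \<open>F\<close> to the Gaussian density, whose
  remainder beyond the linear term is \<open>O(|v|\<^sup>2)\<close> in \<open>L\<^sup>1\<close>. So boundedness of \<open>F\<close> suffices.\<close>

lemma std_gaussian_shift_has_derivative:
  fixes F :: "'a::euclidean_space \<Rightarrow> real"
  assumes F[measurable]: "F \<in> borel_measurable borel" and bnd: "bounded (range F)"
  shows "((\<lambda>v. \<integral>x. F (x + v) \<partial>std_gaussian) has_derivative (\<lambda>v. \<integral>x. F x * (v \<bullet> x) \<partial>std_gaussian)) (at 0)"
proof -
  obtain K where K: "\<And>x. \<bar>F x\<bar> \<le> K" using bnd by (auto simp: bounded_iff)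
  have K0: "0 \<le> K" using K[of 0] by linarith
  have iF: "integrable std_gaussian (\<lambda>x. F x * g x)" if "integrable std_gaussian g" for g
  proof (rule Bochner_Integration.integrable_bound)
    show "integrable std_gaussian (\<lambda>x. K * g x)" using that by simp
    show "(\<lambda>x. F x * g x) \<in> borel_measurable std_gaussian" using that by measurable
    show "AE x in std_gaussian. norm (F x * g x) \<le> norm (K * g x)"
      using K K0 by (intro AE_I2) (auto simp: abs_mult intro!: mult_right_mono)
  qed
  define D where "D v = (\<integral>x. F x * (v \<bullet> x) \<partial>std_gaussian)" for v
  have iD: "integrable std_gaussian (\<lambda>x. F x * (v \<bullet> x))" for v
    by (intro iF std_gaussian_integrable_inner)
  have "linear D"
    by (rule linearI) (simp_all add: D_def inner_add_left distrib_left iD mult.left_commute)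
  then have blD: "bounded_linear D" by (simp add: linear_conv_bounded_linear)
  define G where "G v = (\<integral>x. F (x + v) \<partial>std_gaussian)" for v
  have iF1: "integrable std_gaussian F" using iF[of "\<lambda>_. 1"] by simp
  have est: "\<bar>G v - G 0 - D v\<bar> \<le> K * sqrt (exp ((norm v)\<^sup>2) - 1 - (norm v)\<^sup>2)" for v
  proof -
    let ?R = "\<lambda>x. shift_density v x - 1 - v \<bullet> x"
    have iE: "integrable std_gaussian (shift_density v)"
      using integrable_mult_shift_density[of "\<lambda>_. 1" v] by simp
    have "G v - G 0 - D v = (\<integral>x. F x * shift_density v x \<partial>std_gaussian) - (\<integral>x. F x \<partial>std_gaussian) - D v"
      by (simp add: G_def integral_mult_shift_density)
    also have "\<dots> = (\<integral>x. F x * ?R x \<partial>std_gaussian)"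
      unfolding D_def using iF[OF iE] iF1 iD[of v] by (simp add: right_diff_distrib)
    also have "\<bar>\<dots>\<bar> \<le> (\<integral>x. \<bar>F x * ?R x\<bar> \<partial>std_gaussian)" by (rule integral_abs_bound)
    also have "\<dots> \<le> (\<integral>x. K * \<bar>?R x\<bar> \<partial>std_gaussian)"
      using integrable_abs[OF iF[OF shift_density_remainder(1)[of v]]] shift_density_remainder(1)[of v] K
      by (intro integral_mono) (auto intro!: mult_right_mono simp: abs_mult)
    also have "\<dots> \<le> K * sqrt (exp ((norm v)\<^sup>2) - 1 - (norm v)\<^sup>2)"
      using shift_density_remainder(2)[of v] K0 by (simp add: mult_left_mono)
    finally show ?thesis .
  qed
  have "((\<lambda>v. norm (G v - G 0 - D v) / norm v) \<longlongrightarrow> 0) (at 0)"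
  proof (rule Lim_null_comparison)
    have "\<forall>\<^sub>F v in at 0. v \<noteq> (0::'a) \<and> norm v \<le> 1"
      by (auto simp: eventually_at intro!: exI[of _ 1])
    then show "\<forall>\<^sub>F v in at 0. norm (norm (G v - G 0 - D v) / norm v) \<le> K * norm v"
    proof eventually_elim
      case (elim v)
      have "\<bar>G v - G 0 - D v\<bar> \<le> K * (norm v)\<^sup>2"
        using est[of v] mult_left_mono[OF exp_remainder_le[of "norm v"] K0] elim by simp
      then show ?case using elim by (simp add: field_simps power2_eq_square)
    qed
    show "((\<lambda>v. K * norm v) \<longlongrightarrow> 0) (at (0::'a))" by (auto intro!: tendsto_eq_intros)
  qed
  then have "(G has_derivative D) (at 0)"
    using blD by (simp add: has_derivative_at2 has_derivative_iff_norm)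
  then show ?thesis unfolding G_def D_def .
qed

section \<open>Weak derivatives of Gaussian families\<close>

text \<open>Cosines are smooth and bounded, so a weak derivative is determined by its values on them.\<close>

lemma signed_integral_eqI_cos:
  fixes \<nu> \<nu>' :: "'a::euclidean_space set \<Rightarrow> real"
  assumes \<nu>: "signed_measure borel \<nu>" and \<nu>': "signed_measure borel \<nu>'"
    and cos: "\<And>u \<alpha>. signed_integral borel \<nu> (\<lambda>x. cos (u \<bullet> x + \<alpha>)) = signed_integral borel \<nu>' (\<lambda>x. cos (u \<bullet> x + \<alpha>))"
    and f: "f \<in> borel_measurable borel" "bounded (range f)"
  shows "signed_integral borel \<nu> f = signed_integral borel \<nu>' f"
proof -
  let ?p = "upper_variation borel" and ?n = "\<lambda>\<nu>. upper_variation borel (\<lambda>A. - \<nu> A)"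
  note s = \<nu> \<nu>' signed_measure_uminus[OF \<nu>] signed_measure_uminus[OF \<nu>']
  note fin = s[THEN finite_measure_upper_variation] and sets = s[THEN sets_upper_variation]
  obtain K where K: "\<And>x. \<bar>f x\<bar> \<le> K" using f(2) by (auto simp: bounded_iff)
  have split: "(\<integral>x. g x \<partial>sum_measure (?p \<nu>) (?n \<nu>')) = (\<integral>x. g x \<partial>?p \<nu>) + (\<integral>x. g x \<partial>?n \<nu>')"
      "(\<integral>x. g x \<partial>sum_measure (?p \<nu>') (?n \<nu>)) = (\<integral>x. g x \<partial>?p \<nu>') + (\<integral>x. g x \<partial>?n \<nu>)"
    if "g \<in> borel_measurable borel" "\<And>x. \<bar>g x\<bar> \<le> C" for g :: "'a \<Rightarrow> real" and C
    by (rule integral_sum_measure[where K=C]; use that fin in \<open>simp add: sets cong: measurable_cong_sets\<close>)+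
  have "sum_measure (?p \<nu>) (?n \<nu>') = sum_measure (?p \<nu>') (?n \<nu>)"
  proof (rule finite_measure_eqI_cos)
    show "(\<integral>x. cos (u \<bullet> x + \<alpha>) \<partial>sum_measure (?p \<nu>) (?n \<nu>')) =
        (\<integral>x. cos (u \<bullet> x + \<alpha>) \<partial>sum_measure (?p \<nu>') (?n \<nu>))" for u \<alpha>
      using cos[of u \<alpha>] split[of "\<lambda>x. cos (u \<bullet> x + \<alpha>)" 1] by (simp add: signed_integral_def)
  qed (use fin sets in \<open>simp_all add: finite_measure_sum_measure sets_sum_measure\<close>)
  then show ?thesis
    using split[OF f(1) K] by (simp add: signed_integral_def)
qed

text \<open>Writing the derivative as a cosine with phase \<open>\<alpha> + \<pi>/2\<close> keeps the induction within one family of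
  functions.\<close>

lemma Ck_scaled_cos:
  fixes u :: "'a::real_inner"
  shows "Ck k (\<lambda>x. c * cos (u \<bullet> x + \<alpha>))"
proof (induction k arbitrary: c \<alpha>)
  case 0 then show ?case by (auto intro!: continuous_intros)
next
  case (Suc k)
  have d: "((\<lambda>x. c * cos (u \<bullet> x + \<alpha>)) has_derivative (\<lambda>v. (c * (u \<bullet> v)) * cos (u \<bullet> x + (\<alpha> + pi / 2)))) (at x)" for x
  proof -
    have "cos (u \<bullet> x + (\<alpha> + pi / 2)) = - sin (u \<bullet> x + \<alpha>)"
      using cos_add[of "u \<bullet> x + \<alpha>" "pi / 2"] by (simp add: add.assoc)
    then show ?thesis by (auto intro!: derivative_eq_intros)
  qed
  then have "(\<lambda>x. frechet_derivative (\<lambda>x. c * cos (u \<bullet> x + \<alpha>)) (at x) v) =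
      (\<lambda>x. (c * (u \<bullet> v)) * cos (u \<bullet> x + (\<alpha> + pi / 2)))" for v
    using frechet_derivative_at[OF d] by (metis (no_types, lifting))
  moreover have "(\<lambda>x. c * cos (u \<bullet> x + \<alpha>)) differentiable (at x)" for x
    using d by (rule differentiableI)
  ultimately show ?case using Suc by simp
qed

lemma smooth_cos: "smooth (\<lambda>x::'a::real_inner. cos (u \<bullet> x + \<alpha>))"
  using Ck_scaled_cos[of _ 1 u \<alpha>] by (simp add: smooth_def)

lemma weak_derivative_cos:
  assumes "weak_derivative P \<theta> \<nu>"
  shows "((\<lambda>\<eta>. \<integral>x. cos (u \<bullet> x + \<alpha>) \<partial>P \<eta>) has_real_derivative
    signed_integral borel \<nu> (\<lambda>x. cos (u \<bullet> x + \<alpha>))) (at \<theta>)"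
  using assms smooth_cos[of u \<alpha>] by (auto simp: weak_derivative_def bounded_iff intro!: exI[of _ 1])

text \<open>A linear right inverse \<open>g\<close> of \<open>B\<close> on its range turns the displacement of the mean into the translation
  \<open>a(\<eta>) = g (m(\<eta>) - m(\<theta>))\<close> of the standard Gaussian variable, to which the chain rule applies. The
  measure \<open>\<nu>\<close> is the image under \<open>z \<mapsto> m(\<theta>) + B z\<close> of the signed measure with Gaussian density
  \<open>g m' \<bullet> z\<close>. It serves all bounded measurable functions at once, not only smooth ones.\<close>

lemma affine_std_gaussian_derivative:
  fixes P :: "real \<Rightarrow> (real^'n) measure" and B :: "real^'d^'n"
  assumes P: "\<And>\<eta>. P \<eta> = distr std_gaussian borel (\<lambda>z. m \<eta> + B *v z)"
    and m': "(m has_vector_derivative m') (at \<theta>)"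
    and rng: "\<And>\<eta>. m \<eta> - m \<theta> \<in> range ((*v) B)"
  obtains \<nu> where "signed_measure borel \<nu>"
    and "\<And>f. f \<in> borel_measurable borel \<Longrightarrow> bounded (range f) \<Longrightarrow>
      ((\<lambda>\<eta>. \<integral>x. f x \<partial>P \<eta>) has_real_derivative signed_integral borel \<nu> f) (at \<theta>)"
proof -
  obtain g where g: "linear g" "\<And>y. y \<in> range ((*v) B) \<Longrightarrow> B *v g y = y"
    using linear_exists_right_inverse_on[OF matrix_vector_mul_linear[of B] subspace_UNIV] by auto
  define a where "a \<eta> = g (m \<eta> - m \<theta>)" for \<eta>
  define a' where "a' = g m'"
  have a0: "a \<theta> = 0" using linear_0[OF g(1)] by (simp add: a_def)
  have Ba: "B *v a \<eta> = m \<eta> - m \<theta>" for \<eta> unfolding a_def by (rule g(2)[OF rng])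
  have "((\<lambda>\<eta>. m \<eta> - m \<theta>) has_vector_derivative m') (at \<theta>)"
    using m' by (auto intro!: derivative_eq_intros)
  then have a': "(a has_vector_derivative a') (at \<theta>)"
    unfolding a_def a'_def
    by (rule bounded_linear.has_vector_derivative[OF linear_conv_bounded_linear[THEN iffD1, OF g(1)]])
  \<comment> \<open>\<open>part 1\<close> and \<open>part (- 1)\<close> carry the positive and the negative part of the density.\<close>
  define part where "part s = distr (density std_gaussian (\<lambda>z. ennreal (max 0 (s * (a' \<bullet> z))))) borel
    (\<lambda>z. m \<theta> + B *v z)" for s
  have i: "integrable std_gaussian (\<lambda>z. max 0 (s * (a' \<bullet> z)))" for s
    using std_gaussian_integrable_inner[of a'] by (intro integrable_max) auto
  have fin: "finite_measure (part s)" for s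
  proof -
    have "(\<integral>\<^sup>+z. ennreal (max 0 (s * (a' \<bullet> z))) \<partial>std_gaussian) < \<infinity>"
      using i[of s] by (subst nn_integral_eq_integral) auto
    then have "finite_measure (density std_gaussian (\<lambda>z. ennreal (max 0 (s * (a' \<bullet> z)))))"
      by (intro finite_measureI) (auto simp: emeasure_density less_top[symmetric])
    then show ?thesis unfolding part_def by (intro finite_measure.finite_measure_distr) auto
  qed
  have sets: "sets (part s) = sets borel" for s by (simp add: part_def)
  define \<nu> where "\<nu> A = measure (part 1) A - measure (part (- 1)) A" for A
  have si: "signed_integral borel \<nu> f = (\<integral>z. f (m \<theta> + B *v z) * (a' \<bullet> z) \<partial>std_gaussian)"
    if f[measurable]: "f \<in> borel_measurable borel" and b: "bounded (range f)" for f
  proof -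
    obtain K where K: "\<And>x. \<bar>f x\<bar> \<le> K" using b by (auto simp: bounded_iff)
    have K0: "0 \<le> K" using K[of 0] by linarith
    have int: "(\<integral>x. f x \<partial>part s) = (\<integral>z. f (m \<theta> + B *v z) * max 0 (s * (a' \<bullet> z)) \<partial>std_gaussian)" for s
      unfolding part_def by (subst integral_distr, simp, simp, subst integral_density) (auto simp: mult.commute)
    have ii: "integrable std_gaussian (\<lambda>z. f (m \<theta> + B *v z) * max 0 (s * (a' \<bullet> z)))" for s
    proof (rule Bochner_Integration.integrable_bound)
      show "integrable std_gaussian (\<lambda>z. K * max 0 (s * (a' \<bullet> z)))" using i[of s] by simp
      show "AE z in std_gaussian. norm (f (m \<theta> + B *v z) * max 0 (s * (a' \<bullet> z))) \<le> norm (K * max 0 (s * (a' \<bullet> z)))"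
        using K K0 by (intro AE_I2) (auto simp: abs_mult intro!: mult_right_mono)
    qed simp
    have "signed_integral borel \<nu> f = (\<integral>x. f x \<partial>part 1) - (\<integral>x. f x \<partial>part (- 1))"
      by (rule signed_integral_difference[OF fin fin sets sets _ f b]) (simp add: \<nu>_def)
    also have "\<dots> = (\<integral>z. f (m \<theta> + B *v z) * max 0 (1 * (a' \<bullet> z)) - f (m \<theta> + B *v z) * max 0 (- 1 * (a' \<bullet> z)) \<partial>std_gaussian)"
      unfolding int by (rule Bochner_Integration.integral_diff[OF ii ii, symmetric])
    also have "\<dots> = (\<integral>z. f (m \<theta> + B *v z) * (a' \<bullet> z) \<partial>std_gaussian)"
      by (intro Bochner_Integration.integral_cong) (auto simp: max_def algebra_simps)
    finally show ?thesis .
  qed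
  show thesis
  proof (rule that)
    show "signed_measure borel \<nu>"
      by (rule signed_measure_difference[OF fin fin sets sets]) (simp add: \<nu>_def)
    fix f :: "real^'n \<Rightarrow> real" assume f[measurable]: "f \<in> borel_measurable borel" and b: "bounded (range f)"
    define F where "F z = f (m \<theta> + B *v z)" for z
    have [measurable]: "F \<in> borel_measurable borel" unfolding F_def by measurable
    have Fb: "bounded (range F)" by (rule bounded_subset[OF b]) (auto simp: F_def)
    have "(\<integral>x. f x \<partial>P \<eta>) = (\<integral>z. F (z + a \<eta>) \<partial>std_gaussian)" for \<eta>
      unfolding P F_def by (subst integral_distr) (auto simp: matrix_vector_right_distrib Ba algebra_simps)
    moreover have "((\<lambda>\<eta>. \<integral>z. F (z + a \<eta>) \<partial>std_gaussian) has_derivative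
        (\<lambda>t. \<integral>z. F z * ((t *\<^sub>R a') \<bullet> z) \<partial>std_gaussian)) (at \<theta>)"
      by (rule has_derivative_compose[OF a'[unfolded has_vector_derivative_def],
          of "\<lambda>v. \<integral>z. F (z + v) \<partial>std_gaussian", unfolded a0, OF std_gaussian_shift_has_derivative])
        (use Fb in auto)
    moreover have "(\<lambda>t. \<integral>z. F z * ((t *\<^sub>R a') \<bullet> z) \<partial>std_gaussian) = (*) (signed_integral borel \<nu> f)"
      by (auto simp: si[OF f b] F_def[symmetric] mult.left_commute mult.commute)
    ultimately show "((\<lambda>\<eta>. \<integral>x. f x \<partial>P \<eta>) has_real_derivative signed_integral borel \<nu> f) (at \<theta>)"
      by (simp add: has_field_derivative_def)
  qed
qed

section \<open>The mean of a weakly differentiable Gaussian family\<close>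

text \<open>A single cosine cannot exclude jumps of \<open>q\<close> by multiples of a period. Averaging the cosines over a
  standard normal frequency \<open>s\<close> does: the average of \<open>cos (s \<delta>)\<close> is \<open>exp (-\<delta>\<^sup>2/2)\<close>, which tends to \<open>1\<close>
  only if \<open>\<delta>\<close> tends to \<open>0\<close>.\<close>

lemma isCont_if_isCont_cos:
  fixes q :: "real \<Rightarrow> real"
  assumes c: "\<And>s \<alpha>. isCont (\<lambda>\<eta>. cos (s * q \<eta> + \<alpha>)) \<theta>"
  shows "isCont q \<theta>"
  unfolding continuous_at_sequentially
proof (intro allI impI)
  fix X assume X: "X \<longlonglongrightarrow> \<theta>"
  define \<delta> where "\<delta> k = q (X k) - q \<theta>" for k
  interpret N: real_distribution std_normal_distribution by (rule real_dist_normal_dist)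
  have "(\<lambda>k. cos (s * \<delta> k)) \<longlonglongrightarrow> 1" for s
  proof -
    have "(\<lambda>k. cos (s * q (X k) + - (s * q \<theta>))) \<longlonglongrightarrow> cos (s * q \<theta> + - (s * q \<theta>))"
      using isCont_tendsto_compose[OF c X] .
    then show ?thesis by (simp add: \<delta>_def right_diff_distrib)
  qed
  then have "(\<lambda>k. \<integral>s. cos (s * \<delta> k) \<partial>std_normal_distribution) \<longlonglongrightarrow> (\<integral>s. 1 \<partial>std_normal_distribution)"
    by (intro integral_dominated_convergence[where w="\<lambda>_. 1"]) auto
  moreover have "(\<integral>s. cos (s * \<delta> k) \<partial>std_normal_distribution) = exp (- (\<delta> k)\<^sup>2 / 2)" for k
    using std_gaussian_cos[of "\<delta> k" 0] by (simp add: std_gaussian_real mult.commute)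
  ultimately have "(\<lambda>k. exp (- (\<delta> k)\<^sup>2 / 2)) \<longlonglongrightarrow> 1"
    using N.prob_space by simp
  then have "(\<lambda>k. ln (exp (- (\<delta> k)\<^sup>2 / 2))) \<longlonglongrightarrow> ln 1"
    by (intro tendsto_ln) auto
  then have "(\<lambda>k. -2 * (- (\<delta> k)\<^sup>2 / 2)) \<longlonglongrightarrow> -2 * 0"
    by (intro tendsto_mult tendsto_const) simp
  then have "(\<lambda>k. sqrt ((\<delta> k)\<^sup>2)) \<longlonglongrightarrow> sqrt 0"
    by (intro tendsto_real_sqrt) simp
  then have "\<delta> \<longlonglongrightarrow> 0" by (simp add: tendsto_rabs_zero_iff)
  then show "(q \<circ> X) \<longlonglongrightarrow> q \<theta>"
    unfolding \<delta>_def comp_def by (simp add: LIM_zero_iff)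
qed

text \<open>By continuity the increment of \<open>q\<close> is eventually smaller than \<open>\<pi>/2\<close> and can be recovered from its
  sine by \<^const>\<open>arcsin\<close>.\<close>

lemma differentiable_if_cos_differentiable:
  fixes q :: "real \<Rightarrow> real"
  assumes d: "\<And>s \<alpha>. (\<lambda>\<eta>. cos (s * q \<eta> + \<alpha>)) differentiable (at \<theta>)"
  shows "q differentiable (at \<theta>)"
proof -
  have "isCont q \<theta>"
    by (rule isCont_if_isCont_cos) (rule differentiable_imp_continuous_within[OF d])
  then have near: "\<forall>\<^sub>F \<eta> in nhds \<theta>. dist (q \<eta>) (q \<theta>) < 1"
    unfolding isCont_def tendsto_at_iff_tendsto_nhds by (rule tendstoD) simp
  have sin: "cos (1 * q \<eta> + (- q \<theta> - pi / 2)) = sin (q \<eta> - q \<theta>)" for \<eta>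
    using cos_diff[of "q \<eta> - q \<theta>" "pi / 2"] by (simp add: algebra_simps)
  obtain D where D: "((\<lambda>\<eta>. sin (q \<eta> - q \<theta>)) has_real_derivative D) (at \<theta>)"
    using d[of 1 "- q \<theta> - pi / 2"] unfolding sin real_differentiable_def by blast
  have "(arcsin has_real_derivative 1) (at (sin (q \<theta> - q \<theta>)))"
    using DERIV_arcsin[of 0] by simp
  from DERIV_add[OF DERIV_const DERIV_chain2[OF this D]]
  have deriv: "((\<lambda>\<eta>. q \<theta> + arcsin (sin (q \<eta> - q \<theta>))) has_real_derivative D) (at \<theta>)"
    by simp
  have ev: "\<forall>\<^sub>F \<eta> in nhds \<theta>. q \<theta> + arcsin (sin (q \<eta> - q \<theta>)) = q \<eta>"
    using near
  proof eventually_elim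
    case (elim \<eta>)
    then have "\<bar>q \<eta> - q \<theta>\<bar> < 1" by (simp add: dist_real_def)
    then show ?case using pi_gt3 by (subst arcsin_sin) auto
  qed
  have "(q has_real_derivative D) (at \<theta>)"
    by (rule DERIV_cong_ev[OF refl ev refl, THEN iffD1, OF deriv])
  then show ?thesis by (auto simp: real_differentiable_def)
qed

text \<open>The range statement needs weak derivatives at every parameter: along a direction \<open>w\<close> orthogonal to
  the range of \<open>B\<close> the law is a point mass, whose derivative is not a measure unless the point is at
  rest, and \<open>w \<bullet> m\<close> is constant because it is at rest at all times.\<close>

lemma
  fixes P :: "real \<Rightarrow> (real^'n) measure" and B :: "real^'d^'n"
  assumes P: "\<And>\<eta>. P \<eta> = distr std_gaussian borel (\<lambda>z. m \<eta> + B *v z)"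
    and weak: "\<And>\<theta>. weak_derivative P \<theta> (\<nu> \<theta>)"
  shows mean_differentiable_if_weak_derivative: "m differentiable (at \<theta>)"
    and mean_diff_in_range_if_weak_derivative: "m \<eta> - m \<theta> \<in> range ((*v) B)"
proof -
  have cos: "((\<lambda>\<eta>. cos (u \<bullet> m \<eta> + \<alpha>) * exp (- (norm (transpose B *v u))\<^sup>2 / 2)) has_real_derivative
      signed_integral borel (\<nu> \<theta>) (\<lambda>x. cos (u \<bullet> x + \<alpha>))) (at \<theta>)" for u \<alpha> \<theta>
    using weak_derivative_cos[OF weak] unfolding P affine_std_gaussian_cos .
  have cosd: "(\<lambda>\<eta>. cos (u \<bullet> m \<eta> + \<alpha>)) differentiable (at \<theta>)" for u \<alpha> \<theta>
  proof -
    have "((\<lambda>\<eta>. cos (u \<bullet> m \<eta> + \<alpha>) * exp (- (norm (transpose B *v u))\<^sup>2 / 2)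
        / exp (- (norm (transpose B *v u))\<^sup>2 / 2)) has_real_derivative
        signed_integral borel (\<nu> \<theta>) (\<lambda>x. cos (u \<bullet> x + \<alpha>)) / exp (- (norm (transpose B *v u))\<^sup>2 / 2)) (at \<theta>)"
      by (rule DERIV_cdivide[OF cos])
    then show ?thesis by (auto simp: real_differentiable_def)
  qed
  have ud: "(\<lambda>\<eta>. u \<bullet> m \<eta>) differentiable (at \<theta>)" for u \<theta>
  proof (rule differentiable_if_cos_differentiable)
    show "(\<lambda>\<eta>. cos (s * (u \<bullet> m \<eta>) + \<alpha>)) differentiable (at \<theta>)" for s \<alpha>
      using cosd[of "s *\<^sub>R u" \<alpha> \<theta>] by simp
  qed
  show "m differentiable (at \<theta>)"
    using ud by (subst differentiable_componentwise_within) (simp add: inner_commute)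
  have const: "w \<bullet> m \<eta> = w \<bullet> m \<theta>" if w: "transpose B *v w = 0" for w \<eta> \<theta>
  proof -
    have "((\<lambda>\<eta>. w \<bullet> m \<eta>) has_real_derivative 0) (at \<theta>)" for \<theta>
    proof -
      obtain k where k: "((\<lambda>\<eta>. w \<bullet> m \<eta>) has_real_derivative k) (at \<theta>)"
        using ud[of w] unfolding real_differentiable_def by blast
      obtain C where C: "\<And>f. f \<in> borel_measurable borel \<Longrightarrow> (\<And>x. \<bar>f x\<bar> \<le> 1) \<Longrightarrow>
          \<bar>signed_integral borel (\<nu> \<theta>) f\<bar> \<le> C"
        using signed_integral_abs_le weak by (metis weak_derivative_def)
      have bound: "s * \<bar>k\<bar> \<le> C" if s: "s \<ge> 0" for s
      proof -
        \<comment> \<open>The phase that makes the slope of the cosine at \<open>\<theta>\<close> maximal.\<close>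
        define \<alpha> where "\<alpha> = pi / 2 - s * (w \<bullet> m \<theta>)"
        have "transpose B *v (s *\<^sub>R w) = 0" using w by (simp add: matrix_vector_mult_scaleR)
        then have "((\<lambda>\<eta>. cos (s * (w \<bullet> m \<eta>) + \<alpha>)) has_real_derivative
            signed_integral borel (\<nu> \<theta>) (\<lambda>x. cos ((s *\<^sub>R w) \<bullet> x + \<alpha>))) (at \<theta>)"
          using cos[of "s *\<^sub>R w" \<alpha>] by simp
        moreover have "((\<lambda>\<eta>. cos (s * (w \<bullet> m \<eta>) + \<alpha>)) has_real_derivative - (s * k)) (at \<theta>)"
          using k by (auto intro!: derivative_eq_intros simp: \<alpha>_def)
        ultimately have "- (s * k) = signed_integral borel (\<nu> \<theta>) (\<lambda>x. cos ((s *\<^sub>R w) \<bullet> x + \<alpha>))"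
          using DERIV_unique by blast
        also have "\<bar>\<dots>\<bar> \<le> C" by (rule C) auto
        finally show ?thesis using s by (simp add: abs_mult)
      qed
      have "k = 0"
      proof (rule ccontr)
        assume "k \<noteq> 0"
        moreover have "0 \<le> C" using bound[of 0] by simp
        ultimately show False using bound[of "(C + 1) / \<bar>k\<bar>"] by simp
      qed
      then show ?thesis using k by simp
    qed
    then show ?thesis using DERIV_isconst_all by blast
  qed
  obtain y z where y: "y \<in> span (range ((*v) B))"
    and z: "\<And>v. v \<in> span (range ((*v) B)) \<Longrightarrow> orthogonal z v" and yz: "m \<eta> - m \<theta> = y + z"
    using orthogonal_subspace_decomp_exists by blast
  have "transpose B *v z = 0"
  proof -
    have "(transpose B *v z) \<bullet> v = 0" for v
      using z[OF span_base[OF rangeI[of "(*v) B" v]]] by (simp add: orthogonal_def dot_lmul_matrix)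
    then show ?thesis by (metis inner_eq_zero_iff)
  qed
  then have "z \<bullet> (y + z) = 0" using const[of z \<eta> \<theta>] by (simp add: inner_diff_right flip: yz)
  moreover have "z \<bullet> y = 0" using z[OF y] by (simp add: orthogonal_def)
  ultimately have "z = 0" by (simp add: inner_add_right)
  moreover have "span (range ((*v) B)) = range ((*v) B)"
    by (intro span_eq_iff[THEN iffD2] linear_subspace_image matrix_vector_mul_linear subspace_UNIV)
  then have "y \<in> range ((*v) B)" using y by (simp only:)
  ultimately show "m \<eta> - m \<theta> \<in> range ((*v) B)" using yz by simp
qed

lemma scaleR_matrix_mult_transpose:
  fixes S :: "real^'d^'n"
  assumes "0 \<le> h"
  shows "h *\<^sub>R (S ** transpose S) = (sqrt h *\<^sub>R S) ** transpose (sqrt h *\<^sub>R S)"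
proof -
  have "(sqrt h *\<^sub>R S) ** transpose (sqrt h *\<^sub>R S) = sqrt h *\<^sub>R sqrt h *\<^sub>R (S ** transpose S)"
    by (simp only: transpose_scalar matrix_scalar_ac scalar_matrix_assoc[symmetric])
  then show ?thesis using assms by simp
qed

text \<open>For \<open>S S\<^sup>T A = 1\<close>, a preimage of \<open>y\<close> under \<open>S\<close> is \<open>S\<^sup>T A y\<close>.\<close>

lemma surj_if_invertible_gram:
  fixes S :: "real^'d^'n"
  assumes inv: "invertible (S ** transpose S)" and "c \<noteq> 0"
  shows "range ((*v) (c *\<^sub>R S)) = UNIV"
proof -
  obtain A where A: "(S ** transpose S) ** A = mat 1" using inv by (auto simp: invertible_def)
  have "y = (c *\<^sub>R S) *v ((1 / c) *\<^sub>R (transpose S *v (A *v y)))" for y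
  proof -
    have "S *v (transpose S *v (A *v y)) = y"
      using A by (simp add: matrix_vector_mul_assoc matrix_mul_assoc)
    then show ?thesis using \<open>c \<noteq> 0\<close>
      by (simp add: matrix_vector_mult_scaleR scaleR_matrix_vector_assoc[symmetric])
  qed
  then show ?thesis by (metis surjI surj_def)
qed

lemma smooth_borel_measurable:
  fixes f :: "real^'n \<Rightarrow> real"
  assumes "smooth f" shows "f \<in> borel_measurable borel"
proof -
  have "Ck 0 f" using assms unfolding smooth_def by blast
  then show ?thesis by (auto intro: borel_measurable_continuous_onI)
qed

section \<open>Hahn--Jordan decomposition of the weak derivative\<close>

text \<open>The weak derivative a priori knows only smooth test functions. It is identified, through cosines,
  with the explicit signed measure of \<open>affine_std_gaussian_derivative\<close>, which differentiates the
  integrals of all bounded measurable functions.\<close>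

lemma affine_gaussian_decomposition:
  fixes P :: "real \<Rightarrow> (real^'n) measure" and B :: "real^'d^'n"
  assumes P: "\<And>\<eta>. P \<eta> = distr std_gaussian borel (\<lambda>z. m \<eta> + B *v z)"
    and weak: "\<And>\<theta>. weak_derivative P \<theta> (\<nu> \<theta>)"
  obtains c \<rho>p \<rho>m where "hahn_jordan_decomposition borel (\<nu> \<theta>) c \<rho>p \<rho>m"
    and "\<And>f. f \<in> borel_measurable borel \<Longrightarrow> bounded (range f) \<Longrightarrow>
      ((\<lambda>\<eta>. \<integral>y. f y \<partial>P \<eta>) has_real_derivative
        c * ((\<integral>y. f y \<partial>\<rho>p) - (\<integral>y. f y \<partial>\<rho>m))) (at \<theta>)"
proof -
  have \<nu>: "signed_measure borel (\<nu> \<theta>)" using weak by (simp add: weak_derivative_def)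
  have "(m has_vector_derivative vector_derivative m (at \<theta>)) (at \<theta>)"
    using mean_differentiable_if_weak_derivative[OF P weak] vector_derivative_works by blast
  from affine_std_gaussian_derivative[OF P this mean_diff_in_range_if_weak_derivative[OF P weak]]
  obtain \<nu>0 where \<nu>0: "signed_measure borel \<nu>0"
    and d: "\<And>f. f \<in> borel_measurable borel \<Longrightarrow> bounded (range f) \<Longrightarrow>
      ((\<lambda>\<eta>. \<integral>x. f x \<partial>P \<eta>) has_real_derivative signed_integral borel \<nu>0 f) (at \<theta>)"
    by blast
  have cosb: "bounded (range (\<lambda>x::real^'n. cos (u \<bullet> x + \<alpha>)))" for u \<alpha>
    by (auto simp: bounded_iff intro!: exI[of _ 1])
  have eq: "signed_integral borel \<nu>0 f = signed_integral borel (\<nu> \<theta>) f"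
    if "f \<in> borel_measurable borel" "bounded (range f)" for f
  proof (rule signed_integral_eqI_cos[OF \<nu>0 \<nu> _ that])
    show "signed_integral borel \<nu>0 (\<lambda>x. cos (u \<bullet> x + \<alpha>)) = signed_integral borel (\<nu> \<theta>) (\<lambda>x. cos (u \<bullet> x + \<alpha>))" for u \<alpha>
      by (rule DERIV_unique[OF d weak_derivative_cos[OF weak]]) (auto intro: cosb)
  qed
  \<comment> \<open>The constant function \<open>1\<close>, written as a cosine, shows that \<open>\<nu> \<theta>\<close> has total mass \<open>0\<close>.\<close>
  have "prob_space (P \<eta>)" for \<eta>
    unfolding P by (rule std_gaussian.prob_space_distr) simp
  then have "((\<lambda>\<eta>. \<integral>x. cos (0 \<bullet> x + 0) \<partial>P \<eta>) has_real_derivative 0) (at \<theta>)"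
    by (simp add: prob_space.prob_space)
  then have "signed_integral borel (\<nu> \<theta>) (\<lambda>x. cos (0 \<bullet> x + 0)) = 0"
    by (rule DERIV_unique[OF weak_derivative_cos[OF weak]])
  moreover have "space (upper_variation borel (\<nu> \<theta>)) = UNIV"
    "space (upper_variation borel (\<lambda>A. - \<nu> \<theta> A)) = UNIV"
    using space_upper_variation[OF \<nu>] space_upper_variation[OF signed_measure_uminus[OF \<nu>]] by auto
  ultimately have "\<nu> \<theta> UNIV = 0"
    using jordan_decomposition[OF \<nu>, of UNIV] by (simp add: signed_integral_def)
  then obtain c \<rho>p \<rho>m where hj: "hahn_jordan_decomposition borel (\<nu> \<theta>) c \<rho>p \<rho>m"
    using ex_hahn_jordan_decomposition[OF \<nu>] by blast
  show thesis
  proof (rule that[OF hj])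
    fix f :: "real^'n \<Rightarrow> real" assume f: "f \<in> borel_measurable borel" "bounded (range f)"
    then show "((\<lambda>\<eta>. \<integral>y. f y \<partial>P \<eta>) has_real_derivative
        c * ((\<integral>y. f y \<partial>\<rho>p) - (\<integral>y. f y \<partial>\<rho>m))) (at \<theta>)"
      using d[OF f] eq[OF f] hahn_jordan_signed_integral[OF hj f] by simp
  qed
qed

theorem theorem2:
  fixes M :: "'w measure"
    and F :: "real \<Rightarrow> 'w measure"
    and W :: "real \<Rightarrow> 'w \<Rightarrow> real^'d"
    and X :: "real \<Rightarrow> real \<Rightarrow> 'w \<Rightarrow> real^'n"
    and b :: "real \<Rightarrow> (real^'n) \<times> real \<Rightarrow> real^'n"
    and \<sigma> :: "(real^'n) \<times> real \<Rightarrow> real^'d^'n"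
    and P :: "real \<Rightarrow> real^'n \<Rightarrow> real \<Rightarrow> (real^'n) measure"
    and T h :: real
  assumes "0 < T"
    and "brownian_motion M F T W"
    and "\<And>\<theta>. ito_solution M F T W (b \<theta>) \<sigma> (X \<theta>)"
    and "\<And>\<theta>. Cb2 (b \<theta>)"
    and "Cb2 \<sigma>"
    and "0 < h"
    and "\<And>\<theta> x t. gaussian_law (x + h *\<^sub>R b \<theta> (x, t)) (h *\<^sub>R diffusion_matrix \<sigma> x t) (P \<theta> x t)"
  shows
    "(\<forall>\<theta> x t.
        (\<lambda>\<eta>. b \<eta> (x, t)) differentiable (at \<theta>) \<and> invertible (diffusion_matrix \<sigma> x t) \<longrightarrow>
        (\<exists>\<nu>. weak_derivative (\<lambda>\<eta>. P \<eta> x t) \<theta> \<nu>)) \<and>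
     (\<forall>x t \<nu>.
        (\<forall>\<theta>. weak_derivative (\<lambda>\<eta>. P \<eta> x t) \<theta> (\<nu> \<theta>)) \<longrightarrow>
        (\<exists>c \<rho>p \<rho>m. \<forall>\<theta>.
           hahn_jordan_decomposition borel (\<nu> \<theta>) (c \<theta>) (\<rho>p \<theta>) (\<rho>m \<theta>) \<and>
           (\<forall>f::real^'n \<Rightarrow> real. f \<in> borel_measurable borel \<and> bounded (range f) \<longrightarrow>
              ((\<lambda>\<eta>. \<integral>y. f y \<partial>P \<eta> x t) has_real_derivative
                 c \<theta> * ((\<integral>y. f y \<partial>\<rho>p \<theta>) - (\<integral>y. f y \<partial>\<rho>m \<theta>))) (at \<theta>))))"
proof (intro conjI allI impI)
  define B where "B x t = sqrt h *\<^sub>R \<sigma> (x, t)" for x t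
  have P: "P \<eta> x t = distr std_gaussian borel (\<lambda>z. (x + h *\<^sub>R b \<eta> (x, t)) + B x t *v z)" for \<eta> x t
    using assms(7)[of x \<eta> t] assms(6) unfolding diffusion_matrix_def B_def
    by (intro gaussian_law_eq_distr) (simp add: scaleR_matrix_mult_transpose)
  {
    fix \<theta> x t
    assume A: "(\<lambda>\<eta>. b \<eta> (x, t)) differentiable (at \<theta>) \<and> invertible (diffusion_matrix \<sigma> x t)"
    then have "((\<lambda>\<eta>. b \<eta> (x, t)) has_vector_derivative vector_derivative (\<lambda>\<eta>. b \<eta> (x, t)) (at \<theta>)) (at \<theta>)"
      using vector_derivative_works by blast
    then have "((\<lambda>\<eta>. x + h *\<^sub>R b \<eta> (x, t)) has_vector_derivative
        h *\<^sub>R vector_derivative (\<lambda>\<eta>. b \<eta> (x, t)) (at \<theta>)) (at \<theta>)"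
      by (auto intro!: derivative_eq_intros)
    moreover have "range ((*v) (B x t)) = UNIV"
      unfolding B_def using A assms(6) by (intro surj_if_invertible_gram) (auto simp: diffusion_matrix_def)
    ultimately obtain \<nu> where "signed_measure borel \<nu>"
      "\<And>f. f \<in> borel_measurable borel \<Longrightarrow> bounded (range f) \<Longrightarrow>
        ((\<lambda>\<eta>. \<integral>y. f y \<partial>P \<eta> x t) has_real_derivative signed_integral borel \<nu> f) (at \<theta>)"
      using affine_std_gaussian_derivative[of "\<lambda>\<eta>. P \<eta> x t" "\<lambda>\<eta>. x + h *\<^sub>R b \<eta> (x, t)" "B x t"] P
      by (metis UNIV_I)
    then show "\<exists>\<nu>. weak_derivative (\<lambda>\<eta>. P \<eta> x t) \<theta> \<nu>"
      unfolding weak_derivative_def by (meson smooth_borel_measurable)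
  next
    fix x t \<nu>
    assume weak: "\<forall>\<theta>. weak_derivative (\<lambda>\<eta>. P \<eta> x t) \<theta> (\<nu> \<theta>)"
    have "\<exists>c \<rho>p \<rho>m. hahn_jordan_decomposition borel (\<nu> \<theta>) c \<rho>p \<rho>m \<and>
        (\<forall>f::real^'n \<Rightarrow> real. f \<in> borel_measurable borel \<and> bounded (range f) \<longrightarrow>
          ((\<lambda>\<eta>. \<integral>y. f y \<partial>P \<eta> x t) has_real_derivative
            c * ((\<integral>y. f y \<partial>\<rho>p) - (\<integral>y. f y \<partial>\<rho>m))) (at \<theta>))" for \<theta>
      using affine_gaussian_decomposition[of "\<lambda>\<eta>. P \<eta> x t", OF P weak[rule_format]] by metis
    then show "\<exists>c \<rho>p \<rho>m. \<forall>\<theta>.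
           hahn_jordan_decomposition borel (\<nu> \<theta>) (c \<theta>) (\<rho>p \<theta>) (\<rho>m \<theta>) \<and>
           (\<forall>f::real^'n \<Rightarrow> real. f \<in> borel_measurable borel \<and> bounded (range f) \<longrightarrow>
              ((\<lambda>\<eta>. \<integral>y. f y \<partial>P \<eta> x t) has_real_derivative
                 c \<theta> * ((\<integral>y. f y \<partial>\<rho>p \<theta>) - (\<integral>y. f y \<partial>\<rho>m \<theta>))) (at \<theta>))"
      by metis
  }
qed

end
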